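(* Let $n\in\mathbb{N}$, let $G_1,\dots,G_n$ be compact abelian groups and, for $j=1,\dots,n$, let $m_j:\widehat{G_j}\to\mathbb{C}$ be a Sidon weight on $G_j$. Set $G=G_1\times\cdots\times G_n$ and $m=m_1\otimes\cdots\otimes m_n$, i.e. $m(\gamma_1,\dots,\gamma_n)=m_1(\gamma_1)\cdots m_n(\gamma_n)$ on $\widehat{G}=\widehat{G_1}\times\cdots\times\widehat{G_n}$. Then there are positive constants $A_{m,n}$ and $B_{m,n}$, depending only on $m$ and $n$, such that $$\Big(\sum_{\gamma\in\widehat{G}}|m(\gamma)\widehat{f}(\gamma)|^2\Big)^{1/2}\le A_{m,n}\int_G|f(x)|\log^{n/2}(1+|f(x)|)\,dx+B_{m,n}$$ for every $f\in L\log^{n/2}L(G)$. In particular, $m=m_1\otimes\cdots\otimes m_n$ is a multiplier from $L\log^{n/2}L(G)$ to $L^2(G)$.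
   Context: For a compact abelian group $G$, $\widehat{G}$ denotes its dual group and integration is with respect to normalized Haar measure. A function $m:\widehat{G}\to\mathbb{C}$ is a Sidon weight on $G$ if there is a constant $S_m>0$ such that $\sum_{\gamma\in\mathrm{supp}(m)}|m(\gamma)\widehat{f}(\gamma)|\le S_m\|f\|_{L^\infty(G)}$ for every trigonometric polynomial $f$ on $G$ whose Fourier transform is supported in $\mathrm{supp}(m)=\{\gamma: m(\gamma)\ne0\}$. For $r\ge0$, $L\log^{r}L(G)$ is the space of measurable $f$ on $G$ with $\int_G|f|\log^{r}(1+|f|)\,dx<\infty$. A bounded function $m$ on $\widehat{G}$ is a multiplier from $X\subset L^1(G)$ to $L^2(G)$ if $\sum_{\gamma\in\widehat{G}}|m(\gamma)\widehat{f}(\gamma)|^2<\infty$ for every $f\in X$. *)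

theory Defs
  imports
    "HOL-Analysis.Analysis"
    "HOL-Algebra.Product_Groups"
    "HOL-Probability.Probability"
begin

locale compact_abelian_group = comm_group G
  for G :: "('a, 'b) monoid_scheme" (structure) +
  fixes T :: "'a topology"
  assumes topspace_eq: "topspace T = carrier G"
    and continuous_mult: "continuous_map (prod_topology T T) T (\<lambda>(x, y). x \<otimes> y)"
    and continuous_inv: "continuous_map T T (\<lambda>x. inv x)"
    and compact: "compact_space T"
    and Hausdorff: "Hausdorff_space T"

text \<open>
  The normalized Haar measure is characterized as the translation-invariant Radon probability
  measure on the full Borel \<open>\<sigma>\<close>-algebra of \<open>T\<close> (for a product of non-metrizable groups this can be
  larger than the product \<open>\<sigma>\<close>-algebra). Outer regularity follows from inner regularity by
  finiteness.
\<close>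
definition normalized_haar_measure ::
    "('a, 'b) monoid_scheme \<Rightarrow> 'a topology \<Rightarrow> 'a measure \<Rightarrow> bool" where
  "normalized_haar_measure G T M \<longleftrightarrow>
     space M = topspace T \<and>
     sets M = sigma_sets (topspace T) {U. openin T U} \<and>
     prob_space M \<and>
     (\<forall>x\<in>carrier G. \<forall>A\<in>sets M. emeasure M (x <#\<^bsub>G\<^esub> A) = emeasure M A) \<and>
     (\<forall>A\<in>sets M. emeasure M A = (SUP K\<in>{K. compactin T K \<and> K \<subseteq> A}. emeasure M K))"

text \<open>
  The underlying set of the dual group. Characters are made \<open>undefined\<close> off the carrier, so that
  equality of characters is equality of functions.
\<close>
definition characters ::
    "('a, 'b) monoid_scheme \<Rightarrow> 'a topology \<Rightarrow> ('a \<Rightarrow> complex) set" where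
  "characters G T =
     {\<gamma> \<in> extensional (carrier G).
        continuous_map T euclidean \<gamma> \<and>
        (\<forall>x\<in>carrier G. cmod (\<gamma> x) = 1) \<and>
        (\<forall>x\<in>carrier G. \<forall>y\<in>carrier G. \<gamma> (x \<otimes>\<^bsub>G\<^esub> y) = \<gamma> x * \<gamma> y)}"

definition fourier :: "'a measure \<Rightarrow> ('a \<Rightarrow> complex) \<Rightarrow> ('a \<Rightarrow> complex) \<Rightarrow> complex" where
  "fourier M f \<gamma> = (\<integral>x. f x * cnj (\<gamma> x) \<partial>M)"

definition trig_polynomials ::
    "('a, 'b) monoid_scheme \<Rightarrow> 'a topology \<Rightarrow> ('a \<Rightarrow> complex) set" where
  "trig_polynomials G T =
     {f. \<exists>F c. finite F \<and> F \<subseteq> characters G T \<and> (\<forall>x\<in>carrier G. f x = (\<Sum>\<gamma>\<in>F. c \<gamma> * \<gamma> x))}"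

definition weight_support ::
    "('a, 'b) monoid_scheme \<Rightarrow> 'a topology \<Rightarrow> (('a \<Rightarrow> complex) \<Rightarrow> complex) \<Rightarrow> ('a \<Rightarrow> complex) set"
  where
  "weight_support G T m = {\<gamma> \<in> characters G T. m \<gamma> \<noteq> 0}"

text \<open>
  For a trigonometric polynomial only finitely many terms of the infinite sum are nonzero.
\<close>
definition Sidon_weight ::
    "('a, 'b) monoid_scheme \<Rightarrow> 'a topology \<Rightarrow> 'a measure \<Rightarrow> (('a \<Rightarrow> complex) \<Rightarrow> complex) \<Rightarrow> bool"
  where
  "Sidon_weight G T M m \<longleftrightarrow>
     (\<exists>S>0. \<forall>f\<in>trig_polynomials G T.
        {\<gamma> \<in> characters G T. fourier M f \<gamma> \<noteq> 0} \<subseteq> weight_support G T m \<longrightarrow>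
        ereal (\<Sum>\<^sub>\<infinity>\<gamma>\<in>weight_support G T m. cmod (m \<gamma> * fourier M f \<gamma>))
          \<le> ereal S * esssup M (\<lambda>x. ereal (cmod (f x))))"

definition LlogL :: "real \<Rightarrow> 'a measure \<Rightarrow> ('a \<Rightarrow> complex) set" where
  "LlogL r M =
     {f \<in> borel_measurable M. integrable M (\<lambda>x. cmod (f x) * ln (1 + cmod (f x)) powr r)}"

definition L2_multiplier ::
    "('a, 'b) monoid_scheme \<Rightarrow> 'a topology \<Rightarrow> 'a measure \<Rightarrow>
     (('a \<Rightarrow> complex) \<Rightarrow> complex) \<Rightarrow> ('a \<Rightarrow> complex) set \<Rightarrow> bool" where
  "L2_multiplier G T M m X \<longleftrightarrow>
     bounded (m ` characters G T) \<and>
     X \<subseteq> {f. integrable M f} \<and>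
     (\<forall>f\<in>X. (\<lambda>\<gamma>. (cmod (m \<gamma> * fourier M f \<gamma>))\<^sup>2) summable_on characters G T)"

text \<open>
  A character of the product group corresponds to the family of its restrictions to the factors;
  \<open>tensor_weight_product_character\<close> and \<open>bij_betw_product_character\<close> below justify the definition of
  the tensor product through this identification.
\<close>
definition coordinate_character ::
    "'i set \<Rightarrow> ('i \<Rightarrow> ('a, 'b) monoid_scheme) \<Rightarrow> 'i \<Rightarrow> (('i \<Rightarrow> 'a) \<Rightarrow> complex) \<Rightarrow> 'a \<Rightarrow> complex" where
  "coordinate_character I G j \<gamma> =
     (\<lambda>x\<in>carrier (G j). \<gamma> (\<lambda>i\<in>I. if i = j then x else \<one>\<^bsub>G i\<^esub>))"

definition tensor_weight ::
    "'i set \<Rightarrow> ('i \<Rightarrow> ('a, 'b) monoid_scheme) \<Rightarrow> ('i \<Rightarrow> ('a \<Rightarrow> complex) \<Rightarrow> complex) \<Rightarrow>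
     (('i \<Rightarrow> 'a) \<Rightarrow> complex) \<Rightarrow> complex" where
  "tensor_weight I G m \<gamma> = (\<Prod>j\<in>I. m j (coordinate_character I G j \<gamma>))"

definition product_character ::
    "'i set \<Rightarrow> ('i \<Rightarrow> ('a, 'b) monoid_scheme) \<Rightarrow> ('i \<Rightarrow> 'a \<Rightarrow> complex) \<Rightarrow> ('i \<Rightarrow> 'a) \<Rightarrow> complex" where
  "product_character I G \<gamma> = (\<lambda>x\<in>(\<Pi>\<^sub>E i\<in>I. carrier (G i)). \<Prod>i\<in>I. \<gamma> i (x i))"

lemma character_one:
  assumes "group G" "\<gamma> \<in> characters G T"
  shows "\<gamma> \<one>\<^bsub>G\<^esub> = 1"
proof -
  interpret group G by fact
  have "\<gamma> \<one>\<^bsub>G\<^esub> * \<gamma> \<one>\<^bsub>G\<^esub> = \<gamma> \<one>\<^bsub>G\<^esub>"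
    using assms(2) by (auto simp: characters_def simp flip: l_one dest!: bspec[OF _ one_closed])
  moreover have "\<gamma> \<one>\<^bsub>G\<^esub> \<noteq> 0"
    using assms(2) by (force simp: characters_def)
  ultimately show ?thesis by simp
qed

lemma coordinate_character_product_character:
  assumes I: "finite I" "j \<in> I" and G: "\<And>i. i \<in> I \<Longrightarrow> group (G i)"
    and \<gamma>: "\<gamma> \<in> (\<Pi>\<^sub>E i\<in>I. characters (G i) (T i))"
  shows "coordinate_character I G j (product_character I G \<gamma>) = \<gamma> j"
proof
  fix x
  show "coordinate_character I G j (product_character I G \<gamma>) x = \<gamma> j x"
  proof (cases "x \<in> carrier (G j)")
    case False
    moreover have "\<gamma> j \<in> extensional (carrier (G j))"
      using \<gamma> I by (auto simp: characters_def PiE_iff)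
    ultimately show ?thesis
      by (simp add: coordinate_character_def extensional_def)
  next
    case True
    have "(\<Prod>i\<in>I. \<gamma> i (if i = j then x else \<one>\<^bsub>G i\<^esub>)) = (\<Prod>i\<in>I. if i = j then \<gamma> j x else 1)"
      using \<gamma> G by (intro prod.cong refl) (auto simp: PiE_iff character_one[where T = "T _"])
    also have "\<dots> = \<gamma> j x"
      using I by simp
    finally have "(\<Prod>i\<in>I. \<gamma> i (if i = j then x else \<one>\<^bsub>G i\<^esub>)) = \<gamma> j x" .
    moreover have "(\<lambda>i\<in>I. if i = j then x else \<one>\<^bsub>G i\<^esub>) \<in> (\<Pi>\<^sub>E i\<in>I. carrier (G i))"
      using True G by (auto simp: PiE_iff group.is_monoid monoid.one_closed)
    ultimately show ?thesis
      using True by (simp add: coordinate_character_def product_character_def cong: prod.cong)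
  qed
qed

lemma tensor_weight_product_character:
  assumes "finite I" "\<And>i. i \<in> I \<Longrightarrow> group (G i)"
    and "\<gamma> \<in> (\<Pi>\<^sub>E i\<in>I. characters (G i) (T i))"
  shows "tensor_weight I G m (product_character I G \<gamma>) = (\<Prod>i\<in>I. m i (\<gamma> i))"
  unfolding tensor_weight_def
  using coordinate_character_product_character[OF assms(1) _ assms(2,3)]
  by (intro prod.cong) auto

lemma product_character_in_characters:
  assumes I: "finite I" and G: "\<And>i. i \<in> I \<Longrightarrow> compact_abelian_group (G i) (T i)"
    and \<gamma>: "\<gamma> \<in> (\<Pi>\<^sub>E i\<in>I. characters (G i) (T i))"
  shows "product_character I G \<gamma> \<in> characters (product_group I G) (product_topology T I)"
proof -
  have top: "topspace (T i) = carrier (G i)" if "i \<in> I" for i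
    using compact_abelian_group.topspace_eq[OF G[OF that]] .
  have grp: "group (G i)" if "i \<in> I" for i
    using G[OF that] by (simp add: compact_abelian_group_def comm_group_def)
  have tp: "topspace (product_topology T I) = (\<Pi>\<^sub>E i\<in>I. carrier (G i))"
    by (auto simp: top PiE_iff)
  have \<gamma>i: "\<gamma> i \<in> characters (G i) (T i)" if "i \<in> I" for i
    using \<gamma> that by auto
  have "continuous_map (product_topology T I) euclidean (\<lambda>x. \<Prod>i\<in>I. \<gamma> i (x i))"
  proof -
    have "continuous_map (product_topology T I) euclidean (\<lambda>x. \<gamma> i (x i))" if i: "i \<in> I" for i
    proof -
      have "continuous_map (T i) euclidean (\<gamma> i)"
        using \<gamma>i[OF i] by (simp add: characters_def)
      from continuous_map_compose[OF continuous_map_product_projection[where X = T, OF i] this]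
      show ?thesis
        by (simp add: o_def)
    qed
    then show ?thesis
      unfolding continuous_map_atin limitin_canonical_iff by (intro ballI tendsto_prod) blast
  qed
  then have "continuous_map (product_topology T I) euclidean (product_character I G \<gamma>)"
    by (rule continuous_map_eq) (simp only: tp product_character_def restrict_apply if_True)
  moreover have "product_character I G \<gamma> \<in> extensional (carrier (product_group I G))"
    by (simp add: product_character_def)
  moreover have "cmod (product_character I G \<gamma> x) = 1" if "x \<in> carrier (product_group I G)" for x
  proof -
    have "(\<Prod>i\<in>I. cmod (\<gamma> i (x i))) = (\<Prod>i\<in>I. 1)"
      using that \<gamma>i by (intro prod.cong refl) (auto simp: characters_def PiE_iff)
    then show ?thesis
      using that by (simp add: product_character_def prod_norm)
  qed
  moreover have "product_character I G \<gamma> (x \<otimes>\<^bsub>product_group I G\<^esub> y) =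
      product_character I G \<gamma> x * product_character I G \<gamma> y"
    if "x \<in> carrier (product_group I G)" "y \<in> carrier (product_group I G)" for x y
  proof -
    have "(\<Prod>i\<in>I. \<gamma> i (x i \<otimes>\<^bsub>G i\<^esub> y i)) = (\<Prod>i\<in>I. \<gamma> i (x i) * \<gamma> i (y i))"
      using that \<gamma>i by (intro prod.cong refl) (auto simp: characters_def PiE_iff)
    moreover have "(\<lambda>i\<in>I. x i \<otimes>\<^bsub>G i\<^esub> y i) \<in> (\<Pi>\<^sub>E i\<in>I. carrier (G i))"
      using that grp by (auto simp: PiE_iff group.is_monoid monoid.m_closed)
    ultimately show ?thesis
      using that by (simp add: product_character_def prod.distrib cong: prod.cong)
  qed
  ultimately show ?thesis
    by (simp add: characters_def)
qed

lemma coordinate_character_in_characters: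
  assumes I: "finite I" "j \<in> I" and G: "\<And>i. i \<in> I \<Longrightarrow> compact_abelian_group (G i) (T i)"
    and \<gamma>: "\<gamma> \<in> characters (product_group I G) (product_topology T I)"
  shows "coordinate_character I G j \<gamma> \<in> characters (G j) (T j)"
proof -
  have top: "topspace (T i) = carrier (G i)" if "i \<in> I" for i
    using compact_abelian_group.topspace_eq[OF G[OF that]] .
  have grp: "group (G i)" if "i \<in> I" for i
    using G[OF that] by (simp add: compact_abelian_group_def comm_group_def)
  define e where "e x = (\<lambda>i\<in>I. if i = j then x else \<one>\<^bsub>G i\<^esub>)" for x
  have e_in: "e x \<in> (\<Pi>\<^sub>E i\<in>I. carrier (G i))" if "x \<in> carrier (G j)" for x
    using that grp by (auto simp: e_def PiE_iff group.is_monoid monoid.one_closed)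
  have e_mult: "e (x \<otimes>\<^bsub>G j\<^esub> y) = e x \<otimes>\<^bsub>product_group I G\<^esub> e y"
    if "x \<in> carrier (G j)" "y \<in> carrier (G j)" for x y
    using grp by (auto simp: e_def fun_eq_iff group.is_monoid monoid.one_closed monoid.l_one)
  have "continuous_map (T j) (product_topology T I) e"
    unfolding continuous_map_componentwise
  proof (intro conjI ballI)
    show "e ` topspace (T j) \<subseteq> extensional I"
      by (auto simp: e_def)
    fix i assume i: "i \<in> I"
    show "continuous_map (T j) (T i) (\<lambda>x. e x i)"
    proof (cases "i = j")
      case True
      then show ?thesis using I by (simp add: e_def)
    next
      case False
      then show ?thesis
        using i grp by (simp add: e_def top group.is_monoid monoid.one_closed)
    qed
  qed
  moreover have "continuous_map (product_topology T I) euclidean \<gamma>"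
    using \<gamma> by (simp add: characters_def)
  ultimately have "continuous_map (T j) euclidean (\<gamma> \<circ> e)"
    by (rule continuous_map_compose)
  then have "continuous_map (T j) euclidean (coordinate_character I G j \<gamma>)"
    by (rule continuous_map_eq) (simp add: top[OF I(2)] coordinate_character_def e_def)
  moreover have "coordinate_character I G j \<gamma> x = \<gamma> (e x)" if "x \<in> carrier (G j)" for x
    using that by (simp add: coordinate_character_def e_def)
  moreover have "coordinate_character I G j \<gamma> \<in> extensional (carrier (G j))"
    by (simp add: coordinate_character_def)
  ultimately show ?thesis
    using \<gamma> e_in e_mult grp[OF I(2)]
    by (simp add: characters_def group.is_monoid monoid.m_closed del: mult_product_group)
qed

lemma product_character_coordinate_character:
  assumes I: "finite I" and G: "\<And>i. i \<in> I \<Longrightarrow> group (G i)"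
    and \<gamma>: "\<gamma> \<in> characters (product_group I G) T"
  shows "product_character I G (\<lambda>j\<in>I. coordinate_character I G j \<gamma>) = \<gamma>"
proof
  fix x
  have one: "\<one>\<^bsub>G i\<^esub> \<in> carrier (G i)" if "i \<in> I" for i
    using G[OF that] by (simp add: group.is_monoid monoid.one_closed)
  show "product_character I G (\<lambda>j\<in>I. coordinate_character I G j \<gamma>) x = \<gamma> x"
  proof (cases "x \<in> (\<Pi>\<^sub>E i\<in>I. carrier (G i))")
    case False
    then show ?thesis
      using \<gamma> by (simp add: product_character_def characters_def extensional_def)
  next
    case True
    define e where "e j = (\<lambda>i\<in>I. if i = j then x j else \<one>\<^bsub>G i\<^esub>)" for j
    define p where "p J = (\<lambda>i\<in>I. if i \<in> J then x i else \<one>\<^bsub>G i\<^esub>)" for J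
    have xi: "x i \<in> carrier (G i)" if "i \<in> I" for i
      using True that by auto
    have e_in: "e j \<in> carrier (product_group I G)" if "j \<in> I" for j
      using that one xi by (auto simp: e_def PiE_iff)
    have p_in: "p J \<in> carrier (product_group I G)" for J
      using one xi by (auto simp: p_def PiE_iff)
    have "\<gamma> (p J) = (\<Prod>j\<in>J. \<gamma> (e j))" if "finite J" "J \<subseteq> I" for J
      using that
    proof (induction J rule: finite_induct)
      case empty
      have "p {} = \<one>\<^bsub>product_group I G\<^esub>"
        by (simp add: p_def)
      moreover have "group (product_group I G)"
        using G by simp
      ultimately show ?case
        using character_one[OF _ \<gamma>] by (simp del: one_product_group)
    next
      case (insert j J)
      have "p (insert j J) = e j \<otimes>\<^bsub>product_group I G\<^esub> p J"
      proof
        fix i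
        show "p (insert j J) i = (e j \<otimes>\<^bsub>product_group I G\<^esub> p J) i"
          using insert.hyps one[of i] xi[of i] G[of i]
          by (auto simp: p_def e_def group.is_monoid monoid.l_one monoid.r_one)
      qed
      moreover have "j \<in> I"
        using insert.prems by simp
      ultimately have "\<gamma> (p (insert j J)) = \<gamma> (e j) * \<gamma> (p J)"
        using \<gamma> e_in p_in unfolding characters_def by (simp del: mult_product_group carrier_product_group)
      then show ?case
        using insert by simp
    qed
    from this[OF I order.refl] have "\<gamma> (p I) = (\<Prod>j\<in>I. \<gamma> (e j))" .
    moreover have "p I = x"
      using True by (auto simp: p_def fun_eq_iff PiE_iff extensional_def)
    ultimately show ?thesis
      using True xi
      by (simp add: product_character_def coordinate_character_def e_def cong: prod.cong)
  qed
qed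

lemma bij_betw_product_character:
  assumes I: "finite I" and G: "\<And>i. i \<in> I \<Longrightarrow> compact_abelian_group (G i) (T i)"
  shows "bij_betw (product_character I G) (\<Pi>\<^sub>E i\<in>I. characters (G i) (T i))
           (characters (product_group I G) (product_topology T I))"
proof -
  have grp: "group (G i)" if "i \<in> I" for i
    using G[OF that] by (simp add: compact_abelian_group_def comm_group_def)
  show ?thesis
  proof (rule bij_betw_byWitness[where f' = "\<lambda>\<gamma>. \<lambda>j\<in>I. coordinate_character I G j \<gamma>"])
    show "\<forall>\<gamma>\<in>\<Pi>\<^sub>E i\<in>I. characters (G i) (T i).
        (\<lambda>j\<in>I. coordinate_character I G j (product_character I G \<gamma>)) = \<gamma>"
    proof
      fix \<gamma> assume \<gamma>: "\<gamma> \<in> (\<Pi>\<^sub>E i\<in>I. characters (G i) (T i))"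
      have "coordinate_character I G j (product_character I G \<gamma>) = \<gamma> j" if "j \<in> I" for j
        using coordinate_character_product_character[where G = G, OF I that _ \<gamma>] grp by blast
      then have "(\<lambda>j\<in>I. coordinate_character I G j (product_character I G \<gamma>)) = restrict \<gamma> I"
        by (intro restrict_ext)
      then show "(\<lambda>j\<in>I. coordinate_character I G j (product_character I G \<gamma>)) = \<gamma>"
        using PiE_restrict[OF \<gamma>] by simp
    qed
    show "\<forall>\<gamma>\<in>characters (product_group I G) (product_topology T I).
        product_character I G (\<lambda>j\<in>I. coordinate_character I G j \<gamma>) = \<gamma>"
      using product_character_coordinate_character[where G = G, OF I] grp by blast
    show "product_character I G ` (\<Pi>\<^sub>E i\<in>I. characters (G i) (T i))
        \<subseteq> characters (product_group I G) (product_topology T I)"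
      using product_character_in_characters[where G = G, OF I G] by blast
    show "(\<lambda>\<gamma>. \<lambda>j\<in>I. coordinate_character I G j \<gamma>) ` characters (product_group I G) (product_topology T I)
        \<subseteq> (\<Pi>\<^sub>E i\<in>I. characters (G i) (T i))"
      using coordinate_character_in_characters[where G = G, OF I _ G] by (auto simp: PiE_iff)
  qed
qed

end

theory Submission
  imports Defs
begin

text \<open>
  By duality the claim reduces to the moment estimate \<open>\<parallel>\<Sum> a m \<gamma>\<parallel>\<^sub>2\<^sub>k \<le> C k\<^sup>n\<^sup>/\<^sup>2 \<parallel>a\<parallel>\<^sub>2\<close> for finite sums over
  the support of \<open>m\<close>, since functions with such moments pair with \<open>L log\<^sup>n\<^sup>/\<^sup>2 L\<close>.
  On a single factor, the Sidon inequality says by Hahn-Banach separation in finite dimensions that for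
  all signs \<open>\<epsilon>\<close> the numbers \<open>\<epsilon>\<^sub>\<gamma> m(\<gamma>)\<close> are limits of Fourier coefficients of finitely supported
  measures of mass at most \<open>S\<close>. Tensor products of these measures do the same on \<open>G\<close> for
  \<open>\<epsilon> = \<epsilon>\<^sub>1 \<otimes> \<dots> \<otimes> \<epsilon>\<^sub>n\<close>. Convolving with them gives \<open>\<parallel>\<Sum> a m \<gamma>\<parallel>\<^sub>p \<le> S\<^sub>1 \<dots> S\<^sub>n \<parallel>\<Sum> \<epsilon> a \<gamma>\<parallel>\<^sub>p\<close> for every choice
  of signs, and averaging over them leaves the Khintchine inequality for a decoupled Rademacher
  chaos of order \<open>n\<close>. Only translation invariance of the Haar measure of \<open>G\<close> enters, never its relation to
  the product measure.
\<close>

section \<open>Decoupled Rademacher chaos\<close>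

text \<open>Jensen's inequality for the convex function \<open>x ^ p\<close> with the normalized
  weights \<open>w i / W\<close>. Clearing the normalization makes the inequality meaningful for
  total weight zero as well.\<close>

lemma power_weighted_sum_le:
  fixes w h :: "'i \<Rightarrow> real"
  assumes "finite A" "\<And>i. i \<in> A \<Longrightarrow> 0 \<le> w i" "\<And>i. i \<in> A \<Longrightarrow> 0 \<le> h i" "p \<ge> 1"
  shows "(\<Sum>i\<in>A. w i * h i) ^ p \<le> (\<Sum>i\<in>A. w i) ^ (p - 1) * (\<Sum>i\<in>A. w i * h i ^ p)"
proof (cases "(\<Sum>i\<in>A. w i) = 0")
  case True
  then have "w i = 0" if "i \<in> A" for i
    using assms that by (simp add: sum_nonneg_eq_0_iff)
  then show ?thesis
    using assms(4) by (simp add: power_0_left)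
next
  case False
  define W where "W = (\<Sum>i\<in>A. w i)"
  have W: "W > 0"
    using False assms(2) by (simp add: W_def sum_nonneg order_less_le)
  have "convex_on {0::real..} (\<lambda>x. x ^ p)"
    using convex_power_even[of p] convex_power_odd[of p]
    by (cases "even p") (auto intro: convex_on_subset)
  from convex_on_sum[OF assms(1) _ this, of "\<lambda>i. w i / W" h]
  have "(\<Sum>i\<in>A. (w i / W) * h i) ^ p \<le> (\<Sum>i\<in>A. (w i / W) * h i ^ p)"
    using assms W False by (force simp: W_def simp flip: sum_divide_distrib)
  then have "(\<Sum>i\<in>A. w i * h i) ^ p / W ^ p \<le> (\<Sum>i\<in>A. w i * h i ^ p) / W"
    by (simp add: power_divide flip: sum_divide_distrib)
  moreover have "W ^ p = W * W ^ (p - 1)"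
    using assms(4) by (simp flip: power_Suc)
  ultimately show ?thesis
    using W by (simp add: W_def[symmetric] field_simps)
qed

text \<open>A substitute for Minkowski's inequality in \<open>L\<^sup>k\<close>.\<close>
lemma sum_power_sum_le:
  fixes h :: "'i \<Rightarrow> 'e \<Rightarrow> real"
  assumes "finite A" "finite E" "k \<ge> 1"
    and h: "\<And>x e. x \<in> A \<Longrightarrow> e \<in> E \<Longrightarrow> 0 \<le> h x e"
    and s: "\<And>x. x \<in> A \<Longrightarrow> 0 \<le> s x"
    and le: "\<And>x. x \<in> A \<Longrightarrow> (\<Sum>e\<in>E. h x e ^ k) \<le> Q * s x ^ k"
  shows "(\<Sum>e\<in>E. (\<Sum>x\<in>A. h x e) ^ k) \<le> Q * (\<Sum>x\<in>A. s x) ^ k"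
proof -
  \<comment> \<open>Where \<open>s x = 0\<close>, the hypothesis forces every \<open>h x e\<close>
    to vanish, so \<open>s x * (h x e / s x) = h x e\<close> survives division by zero. Jensen's
    inequality can then be applied with the weights \<open>s x\<close>.\<close>
  have h0: "h x e = 0" if "x \<in> A" "e \<in> E" "s x = 0" for x e
  proof -
    have "(\<Sum>e\<in>E. h x e ^ k) \<le> 0"
      using le[OF that(1)] that(3) assms(3) by (simp add: power_0_left)
    then have "(\<Sum>e\<in>E. h x e ^ k) = 0"
      using h[OF that(1)] by (intro antisym sum_nonneg) auto
    then have "h x e ^ k = 0"
      using assms(2) h[OF that(1)] that(2) by (subst (asm) sum_nonneg_eq_0_iff) auto
    then show ?thesis by simp
  qed
  have "(\<Sum>e\<in>E. (\<Sum>x\<in>A. h x e) ^ k) = (\<Sum>e\<in>E. (\<Sum>x\<in>A. s x * (h x e / s x)) ^ k)"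
    using h0 by (intro sum.cong arg_cong[where f = "\<lambda>x. x ^ k"] refl) auto
  also have "\<dots> \<le> (\<Sum>e\<in>E. (\<Sum>x\<in>A. s x) ^ (k - 1) * (\<Sum>x\<in>A. s x * (h x e / s x) ^ k))"
    using assms by (intro sum_mono power_weighted_sum_le) auto
  also have "\<dots> = (\<Sum>x\<in>A. s x) ^ (k - 1) * (\<Sum>x\<in>A. s x * ((\<Sum>e\<in>E. h x e ^ k) / s x ^ k))"
    unfolding sum_distrib_left[symmetric] power_divide
    by (subst sum.swap) (simp add: sum_distrib_left sum_divide_distrib)
  also have "\<dots> \<le> (\<Sum>x\<in>A. s x) ^ (k - 1) * (\<Sum>x\<in>A. Q * s x)"
  proof (intro mult_left_mono sum_mono zero_le_power sum_nonneg s)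
    fix x assume x: "x \<in> A"
    show "s x * ((\<Sum>e\<in>E. h x e ^ k) / s x ^ k) \<le> Q * s x"
    proof (cases "s x = 0")
      case False
      then have "s x ^ k > 0"
        using s[OF x] by simp
      then have "(\<Sum>e\<in>E. h x e ^ k) / s x ^ k \<le> Q"
        using le[OF x] by (simp add: field_simps)
      from mult_left_mono[OF this s[OF x]] show ?thesis
        by (simp add: mult.commute)
    qed simp
  qed auto
  also have "\<dots> = Q * (\<Sum>x\<in>A. s x) ^ k"
    using assms(3) by (cases k) (simp_all add: sum_distrib_left[symmetric])
  finally show ?thesis .
qed

section \<open>Moments of Rademacher sums, then of decoupled chaoses\<close>

lemma sum_PiE_insert:
  assumes "i \<notin> I"
  shows "(\<Sum>g\<in>PiE (insert i I) B. f g) = (\<Sum>y\<in>B i. \<Sum>g\<in>PiE I B. f (g(i := y)))"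
  unfolding PiE_insert_eq sum.cartesian_product
  by (subst sum.reindex[OF inj_combinator[OF assms]]) (simp add: case_prod_unfold)

text \<open>The Taylor series are compared term by term, via
  \<open>fact n \<le> fact (2 * n)\<close>. The exponent is twice the optimal one, which only
  affects constants.\<close>

lemma cosh_le_exp_square: "cosh (x::real) \<le> exp (x\<^sup>2)"
proof -
  have 1: "(\<lambda>n. x ^ (2 * n) / fact (2 * n)) sums cosh x"
  proof -
    have "strict_mono ((*) (2::nat))"
      by (simp add: strict_mono_def)
    moreover have "(if even n then x ^ n /\<^sub>R fact n else 0) = 0" if "n \<notin> range ((*) (2::nat))" for n
      using that by (auto elim!: evenE)
    ultimately have "(\<lambda>n. if even (2 * n) then x ^ (2 * n) /\<^sub>R fact (2 * n) else 0) sums cosh x"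
      using cosh_converges[of x]
      by (intro sums_mono_reindex[of "(*) 2" "\<lambda>n. if even n then x ^ n /\<^sub>R fact n else 0", THEN iffD2])
    then show ?thesis
      by (simp add: divide_inverse mult.commute)
  qed
  have 2: "(\<lambda>n. (x\<^sup>2) ^ n / fact n) sums exp (x\<^sup>2)"
    using exp_converges[of "x\<^sup>2"] by (simp add: divide_inverse mult.commute)
  have "x ^ (2 * n) / fact (2 * n) \<le> (x\<^sup>2) ^ n / fact n" for n
    by (auto simp: power_mult intro!: divide_left_mono fact_mono)
  from sums_le[OF this 1 2] show ?thesis .
qed

text \<open>A single term of the exponential series is at most its sum. This serves for the moments
  of sign sums and, later, to trade the factor \<open>real k ^ n\<close> for a geometric
  one.\<close>

lemma power_le_fact_exp:
  assumes "(y::real) \<ge> 0"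
  shows "y ^ k \<le> fact k * exp y"
proof -
  have "(\<lambda>n. y ^ n / fact n) sums exp y"
    using exp_converges[of y] by (simp add: divide_inverse mult.commute)
  from sum_le_suminf[OF sums_summable[OF this], of "{k}"] sums_unique[OF this]
  have "y ^ k / fact k \<le> exp y"
    using assms by simp
  then show ?thesis by (simp add: field_simps)
qed

lemma exp_of_nat_le_3_power: "exp (real k) \<le> 3 ^ k"
proof -
  have "exp (real k) = exp 1 ^ k"
    by (simp flip: exp_of_nat_mult)
  also have "\<dots> \<le> 3 ^ k"
    using exp_le by (intro power_mono) auto
  finally show ?thesis .
qed

text \<open>The moment generating function of a Rademacher sum: the exponential factors, and each
  factor sums to \<open>2 * cosh (b x)\<close>. Expectations are written as unnormalized sums over
  sign vectors, hence the factor \<open>2 ^ card F\<close>.\<close>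

lemma sum_signs_exp_le:
  fixes b :: "'i \<Rightarrow> real"
  assumes "finite F"
  shows "(\<Sum>\<epsilon>\<in>PiE F (\<lambda>_. {1, -1}). exp (\<Sum>x\<in>F. \<epsilon> x * b x)) \<le> 2 ^ card F * exp (\<Sum>x\<in>F. (b x)\<^sup>2)"
proof -
  have "(\<Sum>\<epsilon>\<in>PiE F (\<lambda>_. {1, -1}). exp (\<Sum>x\<in>F. \<epsilon> x * b x)) =
      (\<Prod>x\<in>F. \<Sum>s\<in>{1, -1}. exp (s * b x))"
    using assms by (subst prod_sum_PiE) (auto simp: exp_sum)
  also have "\<dots> = (\<Prod>x\<in>F. 2 * cosh (b x))"
    by (intro prod.cong refl) (simp add: cosh_field_def add_divide_distrib)
  also have "\<dots> \<le> (\<Prod>x\<in>F. 2 * exp ((b x)\<^sup>2))"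
    by (intro prod_mono) (auto intro: cosh_le_exp_square)
  also have "\<dots> = 2 ^ card F * exp (\<Sum>x\<in>F. (b x)\<^sup>2)"
    using assms by (simp add: prod.distrib exp_sum)
  finally show ?thesis .
qed

text \<open>Even moments are dominated by exponential moments of the rescaled sum, and the scale is
  then optimized.\<close>

lemma Khintchine_real:
  fixes b :: "'i \<Rightarrow> real"
  assumes "finite F" "k \<ge> 1"
  shows "(\<Sum>\<epsilon>\<in>PiE F (\<lambda>_. {1, -1}). (\<Sum>x\<in>F. \<epsilon> x * b x) ^ (2 * k))
    \<le> 2 ^ card F * (24 * real k) ^ k * (\<Sum>x\<in>F. (b x)\<^sup>2) ^ k"
proof (cases "(\<Sum>x\<in>F. (b x)\<^sup>2) = 0")
  case True
  then have "b x = 0" if "x \<in> F" for x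
    using assms(1) that by (simp add: sum_nonneg_eq_0_iff)
  then have "(\<Sum>\<epsilon>\<in>PiE F (\<lambda>_. {1, -1}). (\<Sum>x\<in>F. \<epsilon> x * b x) ^ (2 * k)) = 0"
    using assms(2) by (intro sum.neutral) auto
  then show ?thesis
    using True assms(2) by simp
next
  case False
  define \<sigma> where "\<sigma> = (\<Sum>x\<in>F. (b x)\<^sup>2)"
  have \<sigma>: "\<sigma> > 0"
    using False by (simp add: \<sigma>_def sum_nonneg order_less_le)
  \<comment> \<open>This scale gives \<open>l\<^sup>2 * \<sigma> = k\<close> and minimizes
    \<open>exp (l\<^sup>2 * \<sigma>) / l ^ (2 * k)\<close>.\<close>
  define l where "l = sqrt (k / \<sigma>)"
  have l2: "l\<^sup>2 = k / \<sigma>"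
    using \<sigma> by (simp add: l_def)
  let ?E = "PiE F (\<lambda>_. {1, -1 :: real})"
  have *: "(\<Sum>\<epsilon>\<in>?E. exp (s * (l * (\<Sum>x\<in>F. \<epsilon> x * b x)))) \<le> 2 ^ card F * exp k" if "s \<in> {1, -1}" for s
  proof -
    have "(\<Sum>x\<in>F. (s * l * b x)\<^sup>2) = l\<^sup>2 * \<sigma>"
      using that by (auto simp: \<sigma>_def power_mult_distrib sum_distrib_left)
    then show ?thesis
      using sum_signs_exp_le[OF assms(1), of "\<lambda>x. s * l * b x"] l2 \<sigma>
      by (simp add: sum_distrib_left mult_ac)
  qed
  have pt: "y ^ (2 * k) \<le> fact (2 * k) * (exp y + exp (- y))" for y :: real
  proof -
    have "y ^ (2 * k) = \<bar>y\<bar> ^ (2 * k)"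
      by (simp add: power_mult)
    also have "\<dots> \<le> fact (2 * k) * exp \<bar>y\<bar>"
      by (rule power_le_fact_exp) simp
    also have "\<dots> \<le> fact (2 * k) * (exp y + exp (- y))"
      by (intro mult_left_mono) (auto simp: abs_if)
    finally show ?thesis .
  qed
  have "l ^ (2 * k) * (\<Sum>\<epsilon>\<in>?E. (\<Sum>x\<in>F. \<epsilon> x * b x) ^ (2 * k)) =
      (\<Sum>\<epsilon>\<in>?E. (l * (\<Sum>x\<in>F. \<epsilon> x * b x)) ^ (2 * k))"
    unfolding power_mult_distrib by (rule sum_distrib_left)
  also have "\<dots> \<le> (\<Sum>\<epsilon>\<in>?E. fact (2 * k) * (exp (l * (\<Sum>x\<in>F. \<epsilon> x * b x)) + exp (- (l * (\<Sum>x\<in>F. \<epsilon> x * b x)))))"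
    by (intro sum_mono pt)
  also have "\<dots> \<le> fact (2 * k) * (2 ^ card F * exp k + 2 ^ card F * exp k)"
    unfolding sum_distrib_left[symmetric] sum.distrib
    using *[of 1] *[of "-1"] by (intro mult_left_mono add_mono) auto
  also have "\<dots> \<le> (2 * real k) ^ (2 * k) * (2 * 2 ^ card F * 3 ^ k)"
  proof (intro mult_mono)
    show "fact (2 * k) \<le> (2 * real k) ^ (2 * k)"
      using fact_le_power[of "2 * k", where 'a = real] by simp
    show "2 ^ card F * exp (real k) + 2 ^ card F * exp (real k) \<le> 2 * 2 ^ card F * 3 ^ k"
      using exp_of_nat_le_3_power[of k] by simp
  qed auto
  also have "\<dots> = (real k ^ k * real k ^ k * 4 ^ k) * (2 * 2 ^ card F * 3 ^ k)"
    by (simp add: power_mult_distrib power_mult flip: power_add mult_2)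
  also have "\<dots> \<le> (real k ^ k * real k ^ k * 4 ^ k) * (2 ^ k * 2 ^ card F * 3 ^ k)"
    using assms(2) self_le_power[of "2::real" k] by (intro mult_left_mono mult_right_mono) auto
  \<comment> \<open>24 = 2 * 4 * 3: the 2 counts the two exponentials, the 4 comes from
    \<open>(2 * real k) ^ (2 * k)\<close>, the 3 from \<open>exp k \<le> 3 ^ k\<close>. The separate
    factor \<open>real k ^ k\<close> cancels against \<open>(real k / \<sigma>) ^ k\<close> on the
    left.\<close>
  also have "\<dots> = real k ^ k * (2 ^ card F * (24 * real k) ^ k)"
    by (simp add: power_mult_distrib mult_ac flip: power_mult_distrib[of 2] power_mult_distrib[of 4] power_mult_distrib[of 3] power_mult_distrib[of 12])
  finally have "(real k / \<sigma>) ^ k * (\<Sum>\<epsilon>\<in>?E. (\<Sum>x\<in>F. \<epsilon> x * b x) ^ (2 * k)) \<le> real k ^ k * (2 ^ card F * (24 * real k) ^ k)"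
    by (simp add: power_mult l2)
  then have "real k ^ k * (\<Sum>\<epsilon>\<in>?E. (\<Sum>x\<in>F. \<epsilon> x * b x) ^ (2 * k)) \<le> real k ^ k * (2 ^ card F * (24 * real k) ^ k * \<sigma> ^ k)"
    using \<sigma> by (simp add: power_divide field_simps)
  then show ?thesis
    using assms(2) by (simp add: \<sigma>_def)
qed

lemma power_sum_two_le:
  assumes "(0::real) \<le> u" "0 \<le> v"
  shows "(u + v) ^ k \<le> 2 ^ k * (u ^ k + v ^ k)"
proof -
  have "(u + v) ^ k \<le> (2 * max u v) ^ k"
    using assms by (intro power_mono) auto
  also have "\<dots> \<le> 2 ^ k * (u ^ k + v ^ k)"
    using assms by (auto simp: power_mult_distrib max_def)
  finally show ?thesis .
qed

text \<open>Real and imaginary parts are treated separately. The constant 96 is 24 times two factors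
  2, one from \<open>power_sum_two_le\<close> and one from adding the two parts.\<close>

lemma Khintchine:
  fixes b :: "'i \<Rightarrow> complex"
  assumes "finite F" "k \<ge> 1"
  shows "(\<Sum>\<epsilon>\<in>PiE F (\<lambda>_. {1, -1 :: real}). cmod (\<Sum>x\<in>F. \<epsilon> x * b x) ^ (2 * k))
    \<le> 2 ^ card F * (96 * real k) ^ k * (\<Sum>x\<in>F. (cmod (b x))\<^sup>2) ^ k"
proof -
  let ?E = "PiE F (\<lambda>_. {1, -1 :: real})"
  let ?s = "\<Sum>x\<in>F. (cmod (b x))\<^sup>2"
  have *: "(\<Sum>\<epsilon>\<in>?E. (\<Sum>x\<in>F. \<epsilon> x * c x) ^ (2 * k)) \<le> 2 ^ card F * (24 * real k) ^ k * ?s ^ k"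
    if "\<And>x. (c x)\<^sup>2 \<le> (cmod (b x))\<^sup>2" for c
  proof -
    have "(\<Sum>x\<in>F. (c x)\<^sup>2) ^ k \<le> ?s ^ k"
      by (intro power_mono sum_mono that sum_nonneg) auto
    then show ?thesis
      by (rule order_trans[OF Khintchine_real[OF assms] mult_left_mono]) simp
  qed
  have "(\<Sum>\<epsilon>\<in>?E. cmod (\<Sum>x\<in>F. \<epsilon> x * b x) ^ (2 * k)) =
    (\<Sum>\<epsilon>\<in>?E. ((\<Sum>x\<in>F. \<epsilon> x * Re (b x))\<^sup>2 + (\<Sum>x\<in>F. \<epsilon> x * Im (b x))\<^sup>2) ^ k)"
    by (simp add: power_mult cmod_power2)
  also have "\<dots> \<le> (\<Sum>\<epsilon>\<in>?E. 2 ^ k * ((\<Sum>x\<in>F. \<epsilon> x * Re (b x)) ^ (2 * k) + (\<Sum>x\<in>F. \<epsilon> x * Im (b x)) ^ (2 * k)))"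
    unfolding power_mult by (intro sum_mono power_sum_two_le) auto
  also have "\<dots> \<le> 2 ^ k * (2 ^ card F * (24 * real k) ^ k * ?s ^ k + 2 ^ card F * (24 * real k) ^ k * ?s ^ k)"
    unfolding sum_distrib_left[symmetric] sum.distrib
    by (intro mult_left_mono add_mono *) (auto simp: abs_Re_le_cmod abs_Im_le_cmod abs_le_square_iff[symmetric])
  also have "\<dots> = 2 * (2 ^ card F * (48 * real k) ^ k * ?s ^ k)"
    by (simp add: power_mult_distrib flip: power_mult_distrib[of 2])
  also have "\<dots> \<le> 2 ^ k * (2 ^ card F * (48 * real k) ^ k * ?s ^ k)"
    using assms(2) self_le_power[of "2::real" k] by (intro mult_right_mono mult_nonneg_nonneg zero_le_power sum_nonneg) auto
  also have "\<dots> = 2 ^ card F * (96 * real k) ^ k * ?s ^ k"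
    by (simp add: power_mult_distrib flip: power_mult_distrib[of 2])
  finally show ?thesis .
qed

text \<open>Induction on the number of sign families. With the other families fixed, the chaos is a
  Rademacher sum in the signs of \<open>i\<close>, so Khintchine's inequality applies; its
  coefficients are chaoses of lower order, which is why \<open>b\<close> stays arbitrary.\<close>

lemma Rademacher_chaos:
  fixes b :: "('i \<Rightarrow> 'c) \<Rightarrow> complex"
  assumes "finite I" "\<And>i. i \<in> I \<Longrightarrow> finite (F i)" "k \<ge> 1"
  shows "(\<Sum>\<epsilon>\<in>PiE I (\<lambda>i. PiE (F i) (\<lambda>_. {1, -1 :: real})).
           cmod (\<Sum>\<kappa>\<in>PiE I F. (\<Prod>i\<in>I. \<epsilon> i (\<kappa> i)) * b \<kappa>) ^ (2 * k))
    \<le> (\<Prod>i\<in>I. 2 ^ card (F i)) * ((96 * real k) ^ k) ^ card I * (\<Sum>\<kappa>\<in>PiE I F. (cmod (b \<kappa>))\<^sup>2) ^ k"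
  using assms(1,2)
proof (induction I arbitrary: b rule: finite_induct)
  case empty
  then show ?case by (simp add: power_mult)
next
  case (insert i I)
  let ?E = "PiE I (\<lambda>i. PiE (F i) (\<lambda>_. {1, -1 :: real}))"
  let ?D = "PiE (F i) (\<lambda>_. {1, -1 :: real})"
  \<comment> \<open>\<open>Y x \<epsilon>\<close> is the chaos with coordinate \<open>i\<close> of
    the multi-index frozen at \<open>x\<close>, \<open>s x\<close> is the square mass of that slice
    of \<open>b\<close>, and \<open>Q\<close> is the constant of the induction hypothesis.\<close>
  define Y where "Y x \<epsilon> = (\<Sum>\<kappa>\<in>PiE I F. (\<Prod>i\<in>I. \<epsilon> i (\<kappa> i)) * b (\<kappa>(i := x)))" for x and \<epsilon> :: "'i \<Rightarrow> 'c \<Rightarrow> real"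
  define s where "s x = (\<Sum>\<kappa>\<in>PiE I F. (cmod (b (\<kappa>(i := x))))\<^sup>2)" for x
  define Q where "Q = (\<Prod>i\<in>I. 2 ^ card (F i)) * ((96 * real k) ^ k) ^ card I"
  have prod_upd: "(\<Prod>j\<in>insert i I. (\<epsilon>(i := \<delta>)) j ((\<kappa>(i := x)) j)) = \<delta> x * (\<Prod>j\<in>I. \<epsilon> j (\<kappa> j))"
    for \<epsilon> :: "'i \<Rightarrow> 'c \<Rightarrow> real" and \<delta> \<kappa> x
  proof -
    have "(\<Prod>j\<in>I. (\<epsilon>(i := \<delta>)) j ((\<kappa>(i := x)) j)) = (\<Prod>j\<in>I. \<epsilon> j (\<kappa> j))"
      using insert.hyps by (intro prod.cong) auto
    then show ?thesis
      using insert.hyps by simp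
  qed
  have eq: "(\<Sum>\<kappa>\<in>PiE (insert i I) F. (\<Prod>j\<in>insert i I. (\<epsilon>(i := \<delta>)) j (\<kappa> j)) * b \<kappa>) = (\<Sum>x\<in>F i. \<delta> x * Y x \<epsilon>)"
    for \<epsilon> :: "'i \<Rightarrow> 'c \<Rightarrow> real" and \<delta>
    unfolding sum_PiE_insert[OF insert.hyps(2)] prod_upd Y_def sum_distrib_left
    by (simp only: of_real_mult mult.assoc)
  have "(\<Sum>\<epsilon>\<in>PiE (insert i I) (\<lambda>i. PiE (F i) (\<lambda>_. {1, -1 :: real})).
           cmod (\<Sum>\<kappa>\<in>PiE (insert i I) F. (\<Prod>i\<in>insert i I. \<epsilon> i (\<kappa> i)) * b \<kappa>) ^ (2 * k))
      = (\<Sum>\<epsilon>\<in>?E. \<Sum>\<delta>\<in>?D. cmod (\<Sum>x\<in>F i. \<delta> x * Y x \<epsilon>) ^ (2 * k))"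
    unfolding sum_PiE_insert[OF insert.hyps(2), of _ "\<lambda>i. PiE (F i) (\<lambda>_. {1, -1 :: real})"] eq
    by (rule sum.swap)
  also have "\<dots> \<le> (\<Sum>\<epsilon>\<in>?E. 2 ^ card (F i) * (96 * real k) ^ k * (\<Sum>x\<in>F i. (cmod (Y x \<epsilon>))\<^sup>2) ^ k)"
    by (rule sum_mono, rule Khintchine) (use insert.prems assms(3) in simp_all)
  also have "\<dots> = 2 ^ card (F i) * (96 * real k) ^ k * (\<Sum>\<epsilon>\<in>?E. (\<Sum>x\<in>F i. (cmod (Y x \<epsilon>))\<^sup>2) ^ k)"
    by (simp add: sum_distrib_left)
  \<comment> \<open>The substitute for Minkowski's inequality, applied to
    \<open>(cmod (Y x \<epsilon>))\<^sup>2\<close>, reduces the sum over \<open>x\<close> to single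
    slices, which the induction hypothesis bounds.\<close>
  also have "\<dots> \<le> 2 ^ card (F i) * (96 * real k) ^ k * (Q * (\<Sum>x\<in>F i. s x) ^ k)"
  proof (intro mult_left_mono sum_power_sum_le)
    fix x assume "x \<in> F i"
    show "(\<Sum>\<epsilon>\<in>?E. ((cmod (Y x \<epsilon>))\<^sup>2) ^ k) \<le> Q * s x ^ k"
      using insert.IH[of "\<lambda>\<kappa>. b (\<kappa>(i := x))"] insert.prems
      by (simp add: Y_def s_def Q_def power_mult)
  qed (use insert assms(3) in \<open>auto simp: s_def intro!: finite_PiE sum_nonneg\<close>)
  also have "(\<Sum>x\<in>F i. s x) = (\<Sum>\<kappa>\<in>PiE (insert i I) F. (cmod (b \<kappa>))\<^sup>2)"
    using insert.hyps by (simp add: sum_PiE_insert s_def)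
  finally show ?case
    using insert.hyps by (simp add: Q_def mult_ac)
qed

section \<open>Limits of finitely supported measures\<close>

text \<open>
  \<open>\<phi> \<gamma> x\<close> plays the role of \<open>\<gamma>(x)\<close>: the family \<open>z\<close> is a limit on \<open>F\<close> of the Fourier-Stieltjes
  coefficients of measures \<open>\<Sum>\<^sub>x w x \<delta>\<^sub>x\<close> of mass at most \<open>S\<close>.
\<close>
definition approximable ::
    "'x set \<Rightarrow> ('c \<Rightarrow> 'x \<Rightarrow> complex) \<Rightarrow> real \<Rightarrow> 'c set \<Rightarrow> ('c \<Rightarrow> complex) \<Rightarrow> bool" where
  "approximable C \<phi> S F z \<longleftrightarrow>
     (\<exists>X w. (\<forall>k::nat. finite (X k) \<and> X k \<subseteq> C \<and> (\<Sum>x\<in>X k. cmod (w k x)) \<le> S) \<and>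
            (\<forall>\<gamma>\<in>F. (\<lambda>k. \<Sum>x\<in>X k. w k x * \<phi> \<gamma> x) \<longlonglongrightarrow> z \<gamma>))"

text \<open>Product measures: sums of products over \<open>PiE\<close> factor, so masses multiply
  and coefficients become products of coefficients. Finite products preserve the limits.\<close>

lemma approximable_PiE:
  assumes I: "finite I"
    and ap: "\<And>i. i \<in> I \<Longrightarrow> approximable (C i) (\<phi> i) (S i) (F i) (z i)"
  shows "approximable (PiE I C) (\<lambda>\<kappa> y. \<Prod>i\<in>I. \<phi> i (\<kappa> i) (y i)) (\<Prod>i\<in>I. S i) (PiE I F)
           (\<lambda>\<kappa>. \<Prod>i\<in>I. z i (\<kappa> i))"
proof -
  have "\<forall>i\<in>I. \<exists>X w. (\<forall>k::nat. finite (X k) \<and> X k \<subseteq> C i \<and> (\<Sum>x\<in>X k. cmod (w k x)) \<le> S i) \<and>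
            (\<forall>\<gamma>\<in>F i. (\<lambda>k. \<Sum>x\<in>X k. w k x * \<phi> i \<gamma> x) \<longlonglongrightarrow> z i \<gamma>)"
    using ap by (simp add: approximable_def)
  from bchoice[OF this] obtain X where "\<forall>i\<in>I. \<exists>w. (\<forall>k::nat. finite (X i k) \<and> X i k \<subseteq> C i \<and> (\<Sum>x\<in>X i k. cmod (w k x)) \<le> S i) \<and>
            (\<forall>\<gamma>\<in>F i. (\<lambda>k. \<Sum>x\<in>X i k. w k x * \<phi> i \<gamma> x) \<longlonglongrightarrow> z i \<gamma>)" ..
  from bchoice[OF this] obtain w where fin: "\<And>i k. i \<in> I \<Longrightarrow> finite (X i k)"
    and sub: "\<And>i k. i \<in> I \<Longrightarrow> X i k \<subseteq> C i"
    and le: "\<And>i k. i \<in> I \<Longrightarrow> (\<Sum>x\<in>X i k. cmod (w i k x)) \<le> S i"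
    and lim: "\<And>i \<gamma>. i \<in> I \<Longrightarrow> \<gamma> \<in> F i \<Longrightarrow> (\<lambda>k. \<Sum>x\<in>X i k. w i k x * \<phi> i \<gamma> x) \<longlonglongrightarrow> z i \<gamma>"
    by blast
  have lim': "(\<lambda>k. \<Sum>x\<in>PiE I (\<lambda>i. X i k). (\<Prod>i\<in>I. w i k (x i)) * (\<Prod>i\<in>I. \<phi> i (\<kappa> i) (x i)))
      \<longlonglongrightarrow> (\<Prod>i\<in>I. z i (\<kappa> i))" if "\<kappa> \<in> PiE I F" for \<kappa>
  proof -
    have "(\<lambda>k. \<Prod>i\<in>I. \<Sum>x\<in>X i k. w i k x * \<phi> i (\<kappa> i) x) \<longlonglongrightarrow> (\<Prod>i\<in>I. z i (\<kappa> i))"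
      using that by (intro tendsto_prod lim) auto
    then show ?thesis
      using I fin by (simp add: prod_sum_PiE prod.distrib)
  qed
  have le': "(\<Sum>x\<in>PiE I (\<lambda>i. X i k). cmod (\<Prod>i\<in>I. w i k (x i))) \<le> (\<Prod>i\<in>I. S i)" for k
  proof -
    have "(\<Sum>x\<in>PiE I (\<lambda>i. X i k). cmod (\<Prod>i\<in>I. w i k (x i))) = (\<Prod>i\<in>I. \<Sum>x\<in>X i k. cmod (w i k x))"
      using I fin by (simp add: prod_sum_PiE prod_norm)
    also have "\<dots> \<le> (\<Prod>i\<in>I. S i)"
      using le by (intro prod_mono) (auto intro: sum_nonneg)
    finally show ?thesis .
  qed
  show ?thesis
    unfolding approximable_def
    using I fin sub le' lim'
    by (intro exI[of _ "\<lambda>k. PiE I (\<lambda>i. X i k)"] exI[of _ "\<lambda>k x. \<Prod>i\<in>I. w i k (x i)"])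
       (auto intro!: finite_PiE PiE_mono dest: sub[THEN subsetD])
qed

text \<open>Used because \<open>product_character\<close> agrees with the plain product of
  characters only on the carrier.\<close>

lemma approximable_cong:
  assumes "\<And>\<kappa> x. \<kappa> \<in> F \<Longrightarrow> x \<in> C \<Longrightarrow> \<phi> \<kappa> x = \<psi> \<kappa> x" and ap: "approximable C \<phi> S F z"
  shows "approximable C \<psi> S F z"
proof -
  obtain X w where X: "\<And>j::nat. finite (X j) \<and> X j \<subseteq> C \<and> (\<Sum>x\<in>X j. cmod (w j x)) \<le> S"
    and lim: "\<And>\<kappa>. \<kappa> \<in> F \<Longrightarrow> (\<lambda>j. \<Sum>x\<in>X j. w j x * \<phi> \<kappa> x) \<longlonglongrightarrow> z \<kappa>"
    using ap unfolding approximable_def by blast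
  have "(\<Sum>x\<in>X j. w j x * \<phi> \<kappa> x) = (\<Sum>x\<in>X j. w j x * \<psi> \<kappa> x)" if "\<kappa> \<in> F" for \<kappa> j
    using assms(1)[OF that] X[of j] by (intro sum.cong) auto
  then show ?thesis
    unfolding approximable_def using X lim by (intro exI[of _ X] exI[of _ w]) simp
qed

text \<open>
  Bipolar theorem for finitely many functionals. Were the squared distance \<open>d\<close> from \<open>z\<close> to the
  absolutely convex hull positive, moving a near-minimizer a little towards the point \<open>x\<close> that nearly
  maximizes the functional \<open>b = cnj (z - v)\<close> would push it below \<open>d\<close>.
\<close>
lemma approximable_bipolar:
  assumes F: "finite F" and S: "S > 0"
    and \<phi>: "\<And>\<gamma> x. \<gamma> \<in> F \<Longrightarrow> x \<in> C \<Longrightarrow> cmod (\<phi> \<gamma> x) \<le> 1"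
    and dual: "\<And>b \<eta>. \<eta> > 0 \<Longrightarrow> \<exists>x\<in>C. cmod (\<Sum>\<gamma>\<in>F. b \<gamma> * z \<gamma>) \<le> S * cmod (\<Sum>\<gamma>\<in>F. b \<gamma> * \<phi> \<gamma> x) + \<eta>"
  shows "approximable C \<phi> S F z"
proof -
  \<comment> \<open>\<open>V\<close> consists of the coefficient families of finitely supported
    measures of mass at most \<open>S\<close>, and \<open>N\<close> is the squared distance to
    \<open>z\<close> on \<open>F\<close>. \<open>D\<close> bounds the squared distance on
    \<open>F\<close> between two families bounded by \<open>S\<close>, whose differences are at most
    \<open>2 * S\<close>.\<close>
  define V where "V = {v. \<exists>X w. finite X \<and> X \<subseteq> C \<and> (\<Sum>x\<in>X. cmod (w x)) \<le> S \<and>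
    (\<forall>\<gamma>. v \<gamma> = (\<Sum>x\<in>X. w x * \<phi> \<gamma> x))}"
  define N where "N v = (\<Sum>\<gamma>\<in>F. (cmod (z \<gamma> - v \<gamma>))\<^sup>2)" for v
  define d where "d = Inf (N ` V)"
  define D where "D = 4 * S\<^sup>2 * card F"
  have D: "D \<ge> 0"
    by (simp add: D_def)
  have N0: "N v \<ge> 0" for v
    by (simp add: N_def sum_nonneg)
  have bdd: "bdd_below (N ` V)"
    using N0 by (intro bdd_belowI[of _ 0]) auto
  have V0: "(\<lambda>_. 0) \<in> V"
    using S by (auto simp: V_def intro!: exI[of _ "{}"])
  have V_bound: "cmod (v \<gamma>) \<le> S" if v: "v \<in> V" and \<gamma>: "\<gamma> \<in> F" for v \<gamma>
  proof -
    obtain X w where X: "finite X" "X \<subseteq> C" "(\<Sum>x\<in>X. cmod (w x)) \<le> S" "\<And>\<gamma>. v \<gamma> = (\<Sum>x\<in>X. w x * \<phi> \<gamma> x)"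
      using v by (auto simp: V_def)
    have "cmod (v \<gamma>) \<le> (\<Sum>x\<in>X. cmod (w x) * cmod (\<phi> \<gamma> x))"
      unfolding X(4) by (rule norm_sum[THEN order_trans]) (simp add: norm_mult)
    also have "\<dots> \<le> (\<Sum>x\<in>X. cmod (w x) * 1)"
      using X \<phi> \<gamma> by (intro sum_mono mult_left_mono) auto
    finally show ?thesis using X by simp
  qed
  \<comment> \<open>The new measure is \<open>1 - t\<close> times the old one plus the mass
    \<open>t * c\<close> at \<open>x\<close>. Its weights \<open>w'\<close> add both contributions,
    since \<open>x\<close> may already lie in \<open>X\<close>.\<close>
  have V_step: "(\<lambda>\<gamma>. (1 - complex_of_real t) * v \<gamma> + t * (c * \<phi> \<gamma> x)) \<in> V"
    if v: "v \<in> V" and x: "x \<in> C" and c: "cmod c \<le> S" and t: "0 \<le> t" "t \<le> 1" for v :: "_ \<Rightarrow> complex" and x c and t :: real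
  proof -
    obtain X w where X: "finite X" "X \<subseteq> C" "(\<Sum>x\<in>X. cmod (w x)) \<le> S" "\<And>\<gamma>. v \<gamma> = (\<Sum>x\<in>X. w x * \<phi> \<gamma> x)"
      using v by (auto simp: V_def)
    define w' where "w' y = complex_of_real (1 - t) * (if y \<in> X then w y else 0) + (if y = x then t * c else 0)" for y
    \<comment> \<open>Stated for a general algebra because it is applied to real masses and to
      complex coefficients.\<close>
    have split: "(\<Sum>y\<in>insert x X. (1 - t) * (if y \<in> X then p y else 0) + (if y = x then t * q y else 0))
        = (1 - t) * (\<Sum>y\<in>X. p y) + t * q x" for p q :: "'b \<Rightarrow> 'd::{real_normed_algebra_1,comm_ring_1}" and t :: 'd
    proof -
      have "(\<Sum>y\<in>insert x X. if y \<in> X then p y else 0) = (\<Sum>y\<in>X. p y)"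
        using X(1) by (intro sum.mono_neutral_cong_right) auto
      then show ?thesis
        using X(1) by (simp add: sum.distrib flip: sum_distrib_left)
    qed
    have "(\<Sum>y\<in>insert x X. cmod (w' y)) \<le>
        (\<Sum>y\<in>insert x X. (1 - t) * (if y \<in> X then cmod (w y) else 0) + (if y = x then t * cmod c else 0))"
    proof (rule sum_mono)
      fix y
      show "cmod (w' y) \<le> (1 - t) * (if y \<in> X then cmod (w y) else 0) + (if y = x then t * cmod c else 0)"
        unfolding w'_def
        by (rule norm_triangle_ineq[THEN order_trans], rule add_mono) (use t in \<open>auto simp: norm_mult simp del: of_real_diff\<close>)
    qed
    also have "\<dots> = (1 - t) * (\<Sum>y\<in>X. cmod (w y)) + t * cmod c"
      by (rule split)
    also have "\<dots> \<le> (1 - t) * S + t * S"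
      using t c X by (intro add_mono mult_left_mono) auto
    finally have 1: "(\<Sum>y\<in>insert x X. cmod (w' y)) \<le> S"
      by (simp add: algebra_simps)
    have 2: "(\<Sum>y\<in>insert x X. w' y * \<phi> \<gamma> y) = (1 - t) * v \<gamma> + t * (c * \<phi> \<gamma> x)" for \<gamma>
    proof -
      have "(\<Sum>y\<in>insert x X. w' y * \<phi> \<gamma> y) = (\<Sum>y\<in>insert x X. (1 - complex_of_real t) * (if y \<in> X then w y * \<phi> \<gamma> y else 0) +
          (if y = x then complex_of_real t * (c * \<phi> \<gamma> y) else 0))"
        by (intro sum.cong refl) (auto simp: w'_def algebra_simps)
      also have "\<dots> = (1 - t) * v \<gamma> + t * (c * \<phi> \<gamma> x)"
        using split[of "complex_of_real t" "\<lambda>y. w y * \<phi> \<gamma> y" "\<lambda>y. c * \<phi> \<gamma> y"] by (simp add: X(4))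
      finally show ?thesis .
    qed
    show ?thesis
      unfolding V_def using X x 1 2 by (auto intro!: exI[of _ "insert x X"] exI[of _ w'])
  qed
  have step: "d \<le> (1 - 2 * t) * N v + 2 * t * \<eta> + t\<^sup>2 * D"
    if v: "v \<in> V" and t: "0 \<le> t" "t \<le> 1" and "\<eta> > 0" for v t \<eta>
  proof -
    define b where "b \<gamma> = cnj (z \<gamma> - v \<gamma>)" for \<gamma>
    obtain x where x: "x \<in> C" and le: "cmod (\<Sum>\<gamma>\<in>F. b \<gamma> * z \<gamma>) \<le> S * cmod (\<Sum>\<gamma>\<in>F. b \<gamma> * \<phi> \<gamma> x) + \<eta>"
      using dual[OF \<open>\<eta> > 0\<close>] by blast
    define P where "P = (\<Sum>\<gamma>\<in>F. b \<gamma> * \<phi> \<gamma> x)"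
    \<comment> \<open>The phase makes \<open>c * P\<close> real and equal to
      \<open>S * cmod P\<close>, so a mass \<open>c\<close> at \<open>x\<close> gives the functional
      \<open>b\<close> its largest value among masses of modulus at most \<open>S\<close> at
      \<open>x\<close>.\<close>
    define c where "c = S * cnj (sgn P)"
    define u where "u \<gamma> = c * \<phi> \<gamma> x" for \<gamma>
    have c: "cmod c \<le> S"
      using S by (simp add: c_def norm_mult norm_sgn)
    have cP: "c * P = S * cmod P"
    proof (cases "P = 0")
      case False
      have "cnj P * P = complex_of_real (cmod P) * complex_of_real (cmod P)"
        by (metis complex_norm_square mult.commute power2_eq_square of_real_power)
      then show ?thesis
        using False by (simp add: c_def sgn_eq mult.assoc)
    qed simp
    have u: "cmod (u \<gamma>) \<le> S" if "\<gamma> \<in> F" for \<gamma>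
      using mult_mono[OF c \<phi>[OF that x]] S by (simp add: u_def norm_mult)
    have uV: "(\<lambda>\<gamma>. (1 - complex_of_real t) * v \<gamma> + t * u \<gamma>) \<in> V"
      using V_step[OF v x c t] by (simp add: u_def)
    have "(\<Sum>\<gamma>\<in>F. b \<gamma> * u \<gamma>) = c * P"
      by (simp add: u_def P_def sum_distrib_left mult_ac)
    then have "Re (\<Sum>\<gamma>\<in>F. b \<gamma> * u \<gamma>) = S * cmod P"
      using cP by simp
    moreover have "Re (\<Sum>\<gamma>\<in>F. b \<gamma> * z \<gamma>) \<le> S * cmod P + \<eta>"
      using le complex_Re_le_cmod order_trans unfolding P_def by blast
    moreover have "Re (\<Sum>\<gamma>\<in>F. b \<gamma> * z \<gamma>) - Re (\<Sum>\<gamma>\<in>F. b \<gamma> * v \<gamma>) = N v"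
      unfolding N_def b_def minus_complex.sel(1)[symmetric] sum_subtractf[symmetric] right_diff_distrib[symmetric] Re_sum
      by (intro sum.cong refl) (simp only: mult.commute[of "cnj _"] complex_mult_cnj cmod_power2 Re_complex_of_real)
    ultimately have Re: "Re (\<Sum>\<gamma>\<in>F. b \<gamma> * (u \<gamma> - v \<gamma>)) \<ge> N v - \<eta>"
      by (simp add: right_diff_distrib sum_subtractf)
    have sq: "(cmod (p - t * q))\<^sup>2 = (cmod p)\<^sup>2 - 2 * t * Re (cnj p * q) + t\<^sup>2 * (cmod q)\<^sup>2" for p q :: complex
      unfolding cmod_power2 by (simp add: power2_eq_square algebra_simps)
    \<comment> \<open>Along the segment from \<open>v\<close> to \<open>u\<close> the linear term
      gains at least \<open>2 * t * (N v - \<eta>)\<close>, while the quadratic term costs at most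
      \<open>t\<^sup>2 * D\<close>.\<close>
    have "d \<le> N (\<lambda>\<gamma>. (1 - complex_of_real t) * v \<gamma> + t * u \<gamma>)"
      unfolding d_def by (intro cInf_lower bdd imageI uV)
    also have "\<dots> = (\<Sum>\<gamma>\<in>F. (cmod ((z \<gamma> - v \<gamma>) - t * (u \<gamma> - v \<gamma>)))\<^sup>2)"
      unfolding N_def by (simp add: algebra_simps)
    also have "\<dots> = N v - 2 * t * Re (\<Sum>\<gamma>\<in>F. b \<gamma> * (u \<gamma> - v \<gamma>)) + t\<^sup>2 * (\<Sum>\<gamma>\<in>F. (cmod (u \<gamma> - v \<gamma>))\<^sup>2)"
      unfolding sq by (simp only: sum.distrib sum_subtractf N_def b_def Re_sum sum_distrib_left)
    also have "\<dots> \<le> N v - 2 * t * (N v - \<eta>) + t\<^sup>2 * D"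
    proof -
      have "(\<Sum>\<gamma>\<in>F. (cmod (u \<gamma> - v \<gamma>))\<^sup>2) \<le> (\<Sum>\<gamma>\<in>F. (2 * S)\<^sup>2)"
      proof (intro sum_mono power_mono)
        fix \<gamma> assume "\<gamma> \<in> F"
        then show "cmod (u \<gamma> - v \<gamma>) \<le> 2 * S"
          using norm_triangle_ineq4[of "u \<gamma>" "v \<gamma>"] u V_bound[OF v] by fastforce
      qed auto
      also have "\<dots> = D"
        by (simp add: D_def power_mult_distrib)
      finally show ?thesis
        using t Re by (intro add_mono diff_mono mult_left_mono) auto
    qed
    finally show ?thesis
      by (simp add: algebra_simps)
  qed
  have "d \<le> 0"
  proof (rule ccontr)
    assume "\<not> d \<le> 0"
    then have d: "d > 0" by simp
    \<comment> \<open>\<open>t \<le> 1/2\<close> keeps \<open>1 - 2 * t\<close> nonnegative, and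
      \<open>D + 1\<close> keeps \<open>t\<close> positive when \<open>F\<close> is empty. With
      \<open>N v < d + d / 12 * t\<close> and \<open>\<eta> = d / 6\<close> the errors are at most
      \<open>t * d * (1/12 + 1/3 + 1/2)\<close>, less than the gain
      \<open>2 * t * d\<close>.\<close>
    define t where "t = min (1/2) (d / (2 * (D + 1)))"
    have t: "0 < t" "t \<le> 1/2" "t * D \<le> d / 2"
    proof -
      have "t * D \<le> d / (2 * (D + 1)) * D"
        unfolding t_def using D by (intro mult_right_mono) auto
      also have "\<dots> \<le> d / 2"
        using d D by (simp add: field_simps)
      finally show "t * D \<le> d / 2" .
      show "0 < t"
        using d D by (simp add: t_def)
      show "t \<le> 1/2"
        unfolding t_def by (rule min.cobounded1)
    qed
    obtain v where v: "v \<in> V" "N v < d + d / 12 * t"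
      using cInf_lessD[of "N ` V" "d + d / 12 * t"] V0 d t unfolding d_def by auto
    have "d \<le> (1 - 2 * t) * N v + 2 * t * (d / 6) + t\<^sup>2 * D"
      using step[OF v(1), of t "d / 6"] t d by auto
    also have "\<dots> \<le> (1 - 2 * t) * (d + d / 12 * t) + 2 * t * (d / 6) + t * (d / 2)"
      using t v by (intro add_mono mult_left_mono) (auto simp: power2_eq_square)
    also have "\<dots> < d"
      using t d by (simp add: algebra_simps add_pos_pos)
    finally show False by simp
  qed
  have ex: "\<exists>v\<in>V. N v < 1 / real (Suc k)" for k
  proof -
    have "d < 1 / real (Suc k)"
      using \<open>d \<le> 0\<close> by (rule le_less_trans) simp
    then show ?thesis
      using cInf_lessD[of "N ` V" "1 / real (Suc k)"] V0 unfolding d_def by auto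
  qed
  define v where "v k = (SOME v. v \<in> V \<and> N v < 1 / real (Suc k))" for k
  have vV: "v k \<in> V" and vN: "N (v k) < 1 / real (Suc k)" for k
    using someI_ex[of "\<lambda>v. v \<in> V \<and> N v < 1 / real (Suc k)"] ex[of k] unfolding v_def by blast+
  obtain X w where Xw: "\<And>k. finite (X k) \<and> X k \<subseteq> C \<and> (\<Sum>x\<in>X k. cmod (w k x)) \<le> S"
    "\<And>k \<gamma>. v k \<gamma> = (\<Sum>x\<in>X k. w k x * \<phi> \<gamma> x)"
    using vV unfolding V_def mem_Collect_eq by metis
  have "(\<lambda>k. v k \<gamma>) \<longlonglongrightarrow> z \<gamma>" if \<gamma>: "\<gamma> \<in> F" for \<gamma>
  proof -
    have "(\<lambda>k. (cmod (z \<gamma> - v k \<gamma>))\<^sup>2) \<longlonglongrightarrow> 0"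
    proof (rule tendsto_sandwich[OF _ _ tendsto_const LIMSEQ_inverse_real_of_nat])
      have "(cmod (z \<gamma> - v k \<gamma>))\<^sup>2 \<le> N (v k)" for k
        unfolding N_def using F \<gamma> by (intro member_le_sum) auto
      then show "\<forall>\<^sub>F k in sequentially. (cmod (z \<gamma> - v k \<gamma>))\<^sup>2 \<le> inverse (real (Suc k))"
        using vN by (intro always_eventually allI) (metis inverse_eq_divide less_imp_le order_trans)
    qed auto
    from tendsto_real_sqrt[OF this] have "(\<lambda>k. cmod (z \<gamma> - v k \<gamma>)) \<longlonglongrightarrow> 0"
      by simp
    then show ?thesis
      using tendsto_diff[OF tendsto_const[of "z \<gamma>"] tendsto_norm_zero_cancel] by fastforce
  qed
  then show ?thesis
    unfolding approximable_def using Xw by (intro exI[of _ X] exI[of _ w]) simp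
qed

section \<open>Sidon weights and Haar measure\<close>

locale Haar_group = compact_abelian_group +
  fixes M :: "'a measure"
  assumes Haar: "normalized_haar_measure G T M"
begin

section \<open>Haar measure: measurability and translation invariance\<close>

lemma space_M: "space M = carrier G"
  using Haar by (simp add: normalized_haar_measure_def topspace_eq)

sublocale prob_space M
  using Haar by (simp add: normalized_haar_measure_def)

lemma continuous_map_borel_measurable:
  assumes "continuous_map T euclidean f"
  shows "f \<in> borel_measurable M"
proof (rule borel_measurableI)
  fix S :: "'c set" assume "open S"
  then have "openin T {x \<in> topspace T. f x \<in> S}"
    using openin_continuous_map_preimage[OF assms] by simp
  moreover have "f -` S \<inter> space M = {x \<in> topspace T. f x \<in> S}"
    by (auto simp: space_M topspace_eq)
  ultimately show "f -` S \<inter> space M \<in> sets M"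
    using Haar by (auto simp: normalized_haar_measure_def)
qed

lemma continuous_map_translation:
  assumes "x \<in> carrier G"
  shows "continuous_map T T (\<lambda>y. x \<otimes> y)"
proof -
  have "continuous_map T (prod_topology T T) (\<lambda>y. (x, y))"
    using assms by (simp add: continuous_map_pairwise o_def topspace_eq)
  from continuous_map_compose[OF this continuous_mult] show ?thesis
    by (simp add: o_def)
qed

lemma measurable_translation:
  assumes x: "x \<in> carrier G"
  shows "(\<lambda>y. x \<otimes> y) \<in> measurable M M"
proof (rule measurable_sigma_sets[of M "topspace T" "{U. openin T U}"])
  show "sets M = sigma_sets (topspace T) {U. openin T U}"
    using Haar by (simp add: normalized_haar_measure_def)
  show "{U. openin T U} \<subseteq> Pow (topspace T)"
    by (auto dest: openin_subset)
  show "(\<lambda>y. x \<otimes> y) \<in> space M \<rightarrow> topspace T"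
    using x by (auto simp: space_M topspace_eq)
  fix U assume "U \<in> {U. openin T U}"
  then have "openin T {y \<in> topspace T. x \<otimes> y \<in> U}"
    using openin_continuous_map_preimage[OF continuous_map_translation[OF x]] by simp
  moreover have "(\<lambda>y. x \<otimes> y) -` U \<inter> space M = {y \<in> topspace T. x \<otimes> y \<in> U}"
    by (auto simp: space_M topspace_eq)
  ultimately show "(\<lambda>y. x \<otimes> y) -` U \<inter> space M \<in> sets M"
    using Haar by (auto simp: normalized_haar_measure_def)
qed

text \<open>The preimage of \<open>A\<close> under translation by \<open>x\<close> is the coset
  \<open>inv x <# A\<close>, to which the invariance in \<open>normalized_haar_measure\<close>
  applies.\<close>

lemma distr_translation:
  assumes x: "x \<in> carrier G"
  shows "distr M M (\<lambda>y. x \<otimes> y) = M"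
proof (rule measure_eqI)
  fix A assume "A \<in> sets (distr M M (\<lambda>y. x \<otimes> y))"
  then have A: "A \<in> sets M" by simp
  then have "A \<subseteq> carrier G"
    using sets.sets_into_space space_M by blast
  have "(\<lambda>y. x \<otimes> y) -` A \<inter> space M = inv x <# A"
  proof (intro equalityI subsetI)
    fix y assume "y \<in> (\<lambda>y. x \<otimes> y) -` A \<inter> space M"
    then have "x \<otimes> y \<in> A" "y = inv x \<otimes> (x \<otimes> y)"
      using x by (auto simp: space_M m_assoc[symmetric])
    then show "y \<in> inv x <# A"
      by (auto simp: l_coset_def)
  next
    fix y assume "y \<in> inv x <# A"
    then show "y \<in> (\<lambda>y. x \<otimes> y) -` A \<inter> space M"
      using x \<open>A \<subseteq> carrier G\<close> by (auto simp: l_coset_def space_M m_assoc[symmetric])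
  qed
  then show "emeasure (distr M M (\<lambda>y. x \<otimes> y)) A = emeasure M A"
    using A x Haar measurable_translation[OF x]
    by (simp add: emeasure_distr normalized_haar_measure_def)
qed simp

lemma integral_translation:
  fixes f :: "'a \<Rightarrow> 'e::{banach, second_countable_topology}"
  assumes "x \<in> carrier G" "f \<in> borel_measurable M"
  shows "(\<integral>y. f (x \<otimes> y) \<partial>M) = (\<integral>y. f y \<partial>M)"
  using integral_distr[OF measurable_translation[OF assms(1)] assms(2)] distr_translation[OF assms(1)]
  by simp

section \<open>Characters, their orthonormality, and Fourier coefficients of polynomials\<close>

lemma character_measurable: "\<gamma> \<in> characters G T \<Longrightarrow> \<gamma> \<in> borel_measurable M"
  by (auto simp: characters_def intro: continuous_map_borel_measurable)

lemma character_mult: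
  "\<gamma> \<in> characters G T \<Longrightarrow> x \<in> carrier G \<Longrightarrow> y \<in> carrier G \<Longrightarrow> \<gamma> (x \<otimes> y) = \<gamma> x * \<gamma> y"
  by (simp add: characters_def)

lemma norm_character: "\<gamma> \<in> characters G T \<Longrightarrow> x \<in> carrier G \<Longrightarrow> cmod (\<gamma> x) = 1"
  by (simp add: characters_def)

lemma integrable_bounded:
  fixes f :: "'a \<Rightarrow> 'e::{banach, second_countable_topology}"
  assumes "f \<in> borel_measurable M" "\<And>x. x \<in> carrier G \<Longrightarrow> norm (f x) \<le> B"
  shows "integrable M f"
  using assms by (intro integrable_const_bound[where B = B]) (auto simp: space_M)

lemma integrable_character_cnj:
  assumes "\<gamma> \<in> characters G T" "\<gamma>' \<in> characters G T"
  shows "integrable M (\<lambda>x. \<gamma> x * cnj (\<gamma>' x))"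
proof -
  have [measurable]: "cnj \<in> borel_measurable borel" "\<gamma> \<in> borel_measurable M" "\<gamma>' \<in> borel_measurable M"
    using assms by (auto intro!: borel_measurable_continuous_onI continuous_intros character_measurable)
  show ?thesis
    using assms by (intro integrable_bounded[where B = 1]) (auto simp: norm_mult norm_character)
qed

text \<open>Translating by a point \<open>x\<close> where the characters differ multiplies the
  integral by \<open>\<gamma> x * cnj (\<gamma>' x)\<close>, which is not 1, so the integral
  vanishes. Such an \<open>x\<close> lies in the carrier because characters are extensional.\<close>

lemma character_orthonormal:
  assumes "\<gamma> \<in> characters G T" "\<gamma>' \<in> characters G T"
  shows "(\<integral>x. \<gamma> x * cnj (\<gamma>' x) \<partial>M) = (if \<gamma> = \<gamma>' then 1 else 0)"
proof (cases "\<gamma> = \<gamma>'")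
  case True
  have "(\<integral>x. \<gamma> x * cnj (\<gamma>' x) \<partial>M) = (\<integral>x. 1 \<partial>M)"
    using assms True
    by (intro Bochner_Integration.integral_cong)
       (auto simp: space_M norm_character simp flip: complex_norm_square)
  then show ?thesis
    using True by (simp add: prob_space)
next
  case False
  have "\<exists>x\<in>carrier G. \<gamma> x \<noteq> \<gamma>' x"
  proof (rule ccontr)
    assume "\<not> ?thesis"
    then have "\<gamma> = \<gamma>'"
      using assms by (intro extensionalityI[of _ "carrier G"]) (auto simp: characters_def)
    with False show False by simp
  qed
  then obtain x where x: "x \<in> carrier G" "\<gamma> x \<noteq> \<gamma>' x" by blast
  define I where "I = (\<integral>y. \<gamma> y * cnj (\<gamma>' y) \<partial>M)"
  have "I = (\<integral>y. \<gamma> (x \<otimes> y) * cnj (\<gamma>' (x \<otimes> y)) \<partial>M)"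
    unfolding I_def using integrable_character_cnj[OF assms] x
    by (intro integral_translation[symmetric]) auto
  also have "\<dots> = (\<integral>y. (\<gamma> x * cnj (\<gamma>' x)) * (\<gamma> y * cnj (\<gamma>' y)) \<partial>M)"
    using assms x by (intro Bochner_Integration.integral_cong) (auto simp: space_M character_mult)
  also have "\<dots> = (\<gamma> x * cnj (\<gamma>' x)) * I"
    unfolding I_def by (rule integral_mult_right_zero)
  finally have "I * \<gamma>' x = I * \<gamma> x * (cnj (\<gamma>' x) * \<gamma>' x)"
    by (metis mult.assoc mult.commute)
  also have "cnj (\<gamma>' x) * \<gamma>' x = 1"
    using assms x by (simp add: norm_character mult.commute[of "cnj _"] flip: complex_norm_square)
  finally have "I = 0"
    using x by simp
  then show ?thesis
    using False by (simp add: I_def)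
qed

lemma fourier_trig_polynomial:
  assumes F: "finite F" "F \<subseteq> characters G T" and \<gamma>: "\<gamma> \<in> characters G T"
  shows "fourier M (\<lambda>x. \<Sum>\<gamma>\<in>F. b \<gamma> * \<gamma> x) \<gamma> = (if \<gamma> \<in> F then b \<gamma> else 0)"
proof -
  have "fourier M (\<lambda>x. \<Sum>\<gamma>\<in>F. b \<gamma> * \<gamma> x) \<gamma> = (\<integral>x. (\<Sum>\<gamma>'\<in>F. b \<gamma>' * (\<gamma>' x * cnj (\<gamma> x))) \<partial>M)"
    by (simp add: fourier_def sum_distrib_right mult.assoc)
  also have "\<dots> = (\<Sum>\<gamma>'\<in>F. b \<gamma>' * (if \<gamma>' = \<gamma> then 1 else 0))"
    using F \<gamma> by (subst Bochner_Integration.integral_sum)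
      (auto intro!: integrable_mult_right integrable_character_cnj simp: character_orthonormal subset_iff intro!: sum.cong)
  also have "\<dots> = (if \<gamma> \<in> F then b \<gamma> else 0)"
    using F(1) by (simp add: if_distrib[of "\<lambda>x. _ * x"] cong: if_cong)
  finally show ?thesis .
qed

text \<open>The body of \<open>Sidon_weight\<close> with the constant exposed, so that the constants
  of the factors can be chosen and multiplied.\<close>

definition Sidon_constant :: "(('a \<Rightarrow> complex) \<Rightarrow> complex) \<Rightarrow> real \<Rightarrow> bool" where
  "Sidon_constant m S \<longleftrightarrow> S > 0 \<and> (\<forall>f\<in>trig_polynomials G T.
        {\<gamma> \<in> characters G T. fourier M f \<gamma> \<noteq> 0} \<subseteq> weight_support G T m \<longrightarrow>
        ereal (\<Sum>\<^sub>\<infinity>\<gamma>\<in>weight_support G T m. cmod (m \<gamma> * fourier M f \<gamma>))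
          \<le> ereal S * esssup M (\<lambda>x. ereal (cmod (f x))))"

lemma Sidon_weight_iff: "Sidon_weight G T M m \<longleftrightarrow> (\<exists>S. Sidon_constant m S)"
  by (auto simp: Sidon_weight_def Sidon_constant_def)

text \<open>A polynomial with frequencies in \<open>F\<close> turns the infinite sum into a finite
  one, and a uniform bound dominates the essential supremum.\<close>

lemma Sidon_constantD:
  assumes S: "Sidon_constant m S" and F: "finite F" "F \<subseteq> weight_support G T m"
    and B: "\<And>x. x \<in> carrier G \<Longrightarrow> cmod (\<Sum>\<gamma>\<in>F. b \<gamma> * \<gamma> x) \<le> B"
  shows "(\<Sum>\<gamma>\<in>F. cmod (m \<gamma> * b \<gamma>)) \<le> S * B"
proof -
  define P where "P x = (\<Sum>\<gamma>\<in>F. b \<gamma> * \<gamma> x)" for x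
  have F': "F \<subseteq> characters G T"
    using F by (auto simp: weight_support_def)
  have fou: "fourier M P \<gamma> = (if \<gamma> \<in> F then b \<gamma> else 0)" if "\<gamma> \<in> characters G T" for \<gamma>
    unfolding P_def by (rule fourier_trig_polynomial[OF F(1) F' that])
  have "P \<in> trig_polynomials G T"
    unfolding trig_polynomials_def P_def using F F' by blast
  moreover have "{\<gamma> \<in> characters G T. fourier M P \<gamma> \<noteq> 0} \<subseteq> weight_support G T m"
    using F fou by (auto split: if_splits)
  ultimately have "ereal (\<Sum>\<^sub>\<infinity>\<gamma>\<in>weight_support G T m. cmod (m \<gamma> * fourier M P \<gamma>))
          \<le> ereal S * esssup M (\<lambda>x. ereal (cmod (P x)))"
    using S by (simp add: Sidon_constant_def)
  also have "(\<Sum>\<^sub>\<infinity>\<gamma>\<in>weight_support G T m. cmod (m \<gamma> * fourier M P \<gamma>)) = (\<Sum>\<^sub>\<infinity>\<gamma>\<in>F. cmod (m \<gamma> * b \<gamma>))"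
    using F fou by (intro infsum_cong_neutral) (auto simp: weight_support_def)
  also have "\<dots> = (\<Sum>\<gamma>\<in>F. cmod (m \<gamma> * b \<gamma>))"
    using F by simp
  also have "ereal S * esssup M (\<lambda>x. ereal (cmod (P x))) \<le> ereal S * ereal B"
  proof (rule ereal_mult_left_mono)
    have [measurable]: "P \<in> borel_measurable M"
      unfolding P_def using F' character_measurable by (intro borel_measurable_sum borel_measurable_times) auto
    then show "esssup M (\<lambda>x. ereal (cmod (P x))) \<le> ereal B"
      using B by (intro esssup_I AE_I2) (measurable, auto simp: space_M P_def)
  qed (use S in \<open>simp add: Sidon_constant_def\<close>)
  finally show ?thesis by simp
qed

text \<open>The Sidon inequality is tested on a single character. This yields the boundedness
  demanded of a multiplier.\<close>

lemma Sidon_weight_bound: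
  assumes "Sidon_constant m S" "\<gamma> \<in> characters G T"
  shows "cmod (m \<gamma>) \<le> S"
proof (cases "m \<gamma> = 0")
  case True
  then show ?thesis using assms by (simp add: Sidon_constant_def)
next
  case False
  then show ?thesis
    using assms Sidon_constantD[OF assms(1), of "{\<gamma>}" "\<lambda>_. 1" 1]
    by (auto simp: weight_support_def norm_character)
qed

text \<open>If the duality condition of \<open>approximable_bipolar\<close> failed for
  \<open>b\<close> and \<open>\<eta>\<close>, the polynomial with coefficients \<open>b\<close>
  would be bounded by \<open>(c - \<eta>) / S\<close>. The Sidon inequality would then bound the sum
  of \<open>cmod (m \<gamma> * b \<gamma>)\<close> by \<open>c - \<eta>\<close>, although that sum
  is at least \<open>c\<close>.\<close>

lemma Sidon_approximable:
  assumes S: "Sidon_constant m S" and F: "finite F" "F \<subseteq> weight_support G T m"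
    and z: "\<And>\<gamma>. \<gamma> \<in> F \<Longrightarrow> cmod (z \<gamma>) \<le> cmod (m \<gamma>)"
  shows "approximable (carrier G) (\<lambda>\<gamma>. \<gamma>) S F z"
proof (rule approximable_bipolar[OF F(1)])
  show S0: "S > 0"
    using S by (simp add: Sidon_constant_def)
  show "cmod (\<gamma> x) \<le> 1" if "\<gamma> \<in> F" "x \<in> carrier G" for \<gamma> x
    using that F by (auto simp: weight_support_def norm_character)
  show "\<exists>x\<in>carrier G. cmod (\<Sum>\<gamma>\<in>F. b \<gamma> * z \<gamma>) \<le> S * cmod (\<Sum>\<gamma>\<in>F. b \<gamma> * \<gamma> x) + \<eta>"
    if \<eta>: "\<eta> > 0" for b and \<eta> :: real
  proof (rule ccontr)
    assume *: "\<not> ?thesis"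
    define c where "c = cmod (\<Sum>\<gamma>\<in>F. b \<gamma> * z \<gamma>)"
    have "cmod (\<Sum>\<gamma>\<in>F. b \<gamma> * \<gamma> x) \<le> (c - \<eta>) / S" if "x \<in> carrier G" for x
      using * that S0 by (auto simp: field_simps not_le c_def intro: less_imp_le)
    from Sidon_constantD[OF S F this] have "(\<Sum>\<gamma>\<in>F. cmod (m \<gamma> * b \<gamma>)) \<le> c - \<eta>"
      using S0 by simp
    moreover have "c \<le> (\<Sum>\<gamma>\<in>F. cmod (m \<gamma> * b \<gamma>))"
      unfolding c_def using z
      by (intro sum_norm_le) (auto simp: norm_mult mult.commute[of "cmod (b _)"] intro!: mult_right_mono)
    ultimately show False using \<eta> by simp
  qed
qed

text \<open>Up to reflection, \<open>h j\<close> is the convolution of \<open>H\<close> with the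
  measure of weights \<open>w j\<close>, that is, a combination of translates of \<open>H\<close>.
  Jensen's inequality and translation invariance bound its \<open>p\<close>-th moment by
  \<open>S ^ p\<close> times that of \<open>H\<close>, uniformly in \<open>j\<close>.\<close>

lemma integral_approximable_le:
  assumes K: "finite K" and \<psi>: "\<And>\<kappa>. \<kappa> \<in> K \<Longrightarrow> \<psi> \<kappa> \<in> characters G T"
    and ap: "approximable (carrier G) \<psi> S K z" and p: "p \<ge> 1"
  shows "(\<integral>y. cmod (\<Sum>\<kappa>\<in>K. a \<kappa> * z \<kappa> * \<psi> \<kappa> y) ^ p \<partial>M) \<le> S ^ p * (\<integral>y. cmod (\<Sum>\<kappa>\<in>K. a \<kappa> * \<psi> \<kappa> y) ^ p \<partial>M)"
proof -
  obtain X w where X: "\<And>j::nat. finite (X j)" "\<And>j. X j \<subseteq> carrier G"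
    and wS: "\<And>j. (\<Sum>x\<in>X j. cmod (w j x)) \<le> S"
    and lim: "\<And>\<kappa>. \<kappa> \<in> K \<Longrightarrow> (\<lambda>j. \<Sum>x\<in>X j. w j x * \<psi> \<kappa> x) \<longlonglongrightarrow> z \<kappa>"
    using ap unfolding approximable_def by blast
  have S: "S \<ge> 0"
    using wS[of 0] by (rule order_trans[rotated]) (simp add: sum_nonneg)
  define v where "v j \<kappa> = (\<Sum>x\<in>X j. w j x * \<psi> \<kappa> x)" for j \<kappa>
  define H where "H y = (\<Sum>\<kappa>\<in>K. a \<kappa> * \<psi> \<kappa> y)" for y
  define h where "h j y = (\<Sum>\<kappa>\<in>K. a \<kappa> * v j \<kappa> * \<psi> \<kappa> y)" for j y
  have \<psi>m: "\<psi> \<kappa> \<in> borel_measurable M" if "\<kappa> \<in> K" for \<kappa>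
    using \<psi>[OF that] by (rule character_measurable)
  have [measurable]: "H \<in> borel_measurable M" "h j \<in> borel_measurable M" for j
    unfolding H_def h_def using \<psi>m by (auto intro!: borel_measurable_sum borel_measurable_times)
  have hm: "(\<lambda>y. \<Sum>\<kappa>\<in>K. a \<kappa> * z \<kappa> * \<psi> \<kappa> y) \<in> borel_measurable M"
    using \<psi>m by (auto intro!: borel_measurable_sum borel_measurable_times)
  have v: "cmod (v j \<kappa>) \<le> S" if "\<kappa> \<in> K" for j \<kappa>
  proof -
    have "cmod (v j \<kappa>) \<le> (\<Sum>x\<in>X j. cmod (w j x))"
      unfolding v_def using X(2)[of j] \<psi>[OF that]
      by (intro sum_norm_le) (auto simp: norm_mult norm_character subset_iff)
    then show ?thesis
      using wS[of j] by simp
  qed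
  have Hb: "cmod (H y) \<le> (\<Sum>\<kappa>\<in>K. cmod (a \<kappa>))" if "y \<in> carrier G" for y
    unfolding H_def using that \<psi> by (intro sum_norm_le) (auto simp: norm_mult norm_character)
  have hb: "cmod (h j y) \<le> (\<Sum>\<kappa>\<in>K. cmod (a \<kappa>) * S)" if "y \<in> carrier G" for j y
    unfolding h_def using that \<psi> v by (intro sum_norm_le) (auto simp: norm_mult norm_character mult_left_mono)
  have Hint: "integrable M (\<lambda>y. cmod (H y) ^ p)"
    using Hb by (intro integrable_bounded[where B = "(\<Sum>\<kappa>\<in>K. cmod (a \<kappa>)) ^ p"]) (auto intro!: power_mono)
  have Hint': "integrable M (\<lambda>y. cmod (H (x \<otimes> y)) ^ p)" if "x \<in> carrier G" for x
    using Hint integrable_distr_eq[OF measurable_translation[OF that], of "\<lambda>y. cmod (H y) ^ p"]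
    by (simp add: distr_translation[OF that])
  have hint: "integrable M (\<lambda>y. cmod (h j y) ^ p)" for j
    using hb by (intro integrable_bounded[where B = "(\<Sum>\<kappa>\<in>K. cmod (a \<kappa>) * S) ^ p"]) (auto intro!: power_mono)
  have le: "(\<integral>y. cmod (h j y) ^ p \<partial>M) \<le> S ^ p * (\<integral>y. cmod (H y) ^ p \<partial>M)" for j
  proof -
    have "cmod (h j y) ^ p \<le> S ^ (p - 1) * (\<Sum>x\<in>X j. cmod (w j x) * cmod (H (x \<otimes> y)) ^ p)"
      if y: "y \<in> carrier G" for y
    proof -
      have "h j y = (\<Sum>\<kappa>\<in>K. \<Sum>x\<in>X j. w j x * (a \<kappa> * \<psi> \<kappa> (x \<otimes> y)))"
        unfolding h_def v_def sum_distrib_left sum_distrib_right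
      proof (intro sum.cong refl)
        fix \<kappa> x assume "\<kappa> \<in> K" "x \<in> X j"
        then have "\<psi> \<kappa> (x \<otimes> y) = \<psi> \<kappa> x * \<psi> \<kappa> y"
          using \<psi> X(2) y by (intro character_mult) auto
        then show "a \<kappa> * (w j x * \<psi> \<kappa> x) * \<psi> \<kappa> y = w j x * (a \<kappa> * \<psi> \<kappa> (x \<otimes> y))"
          by (simp add: mult_ac)
      qed
      also have "\<dots> = (\<Sum>x\<in>X j. w j x * H (x \<otimes> y))"
        unfolding H_def sum_distrib_left by (rule sum.swap)
      finally have "cmod (h j y) \<le> (\<Sum>x\<in>X j. cmod (w j x) * cmod (H (x \<otimes> y)))"
        by (auto intro!: sum_norm_le simp: norm_mult)
      then have "cmod (h j y) ^ p \<le> (\<Sum>x\<in>X j. cmod (w j x) * cmod (H (x \<otimes> y))) ^ p"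
        by (intro power_mono) auto
      also have "\<dots> \<le> (\<Sum>x\<in>X j. cmod (w j x)) ^ (p - 1) * (\<Sum>x\<in>X j. cmod (w j x) * cmod (H (x \<otimes> y)) ^ p)"
        using X p by (intro power_weighted_sum_le) auto
      also have "\<dots> \<le> S ^ (p - 1) * (\<Sum>x\<in>X j. cmod (w j x) * cmod (H (x \<otimes> y)) ^ p)"
        using wS by (intro mult_right_mono power_mono sum_nonneg) auto
      finally show ?thesis .
    qed
    then have "(\<integral>y. cmod (h j y) ^ p \<partial>M) \<le>
        (\<integral>y. S ^ (p - 1) * (\<Sum>x\<in>X j. cmod (w j x) * cmod (H (x \<otimes> y)) ^ p) \<partial>M)"
      using X(2)[of j] Hint'
      by (intro integral_mono hint integrable_mult_right Bochner_Integration.integrable_sum)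
         (auto simp: space_M)
    also have "\<dots> = S ^ (p - 1) * (\<Sum>x\<in>X j. cmod (w j x) * (\<integral>y. cmod (H (x \<otimes> y)) ^ p \<partial>M))"
      using X(2)[of j] Hint' by (subst integral_mult_right_zero, subst Bochner_Integration.integral_sum) auto
    also have "\<dots> = S ^ (p - 1) * (\<Sum>x\<in>X j. cmod (w j x) * (\<integral>y. cmod (H y) ^ p \<partial>M))"
      using X(2)[of j] by (intro arg_cong2[where f = "(*)"] sum.cong refl integral_translation) auto
    also have "\<dots> = S ^ (p - 1) * ((\<Sum>x\<in>X j. cmod (w j x)) * (\<integral>y. cmod (H y) ^ p \<partial>M))"
      by (simp add: sum_distrib_right)
    also have "\<dots> \<le> S ^ (p - 1) * (S * (\<integral>y. cmod (H y) ^ p \<partial>M))"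
      using wS[of j] S by (intro mult_left_mono mult_right_mono) auto
    also have "\<dots> = S ^ p * (\<integral>y. cmod (H y) ^ p \<partial>M)"
      using p by (cases p) auto
    finally show ?thesis .
  qed
  \<comment> \<open>The coefficients \<open>v j\<close> converge to \<open>z\<close> and are bounded
    by \<open>S\<close>, so dominated convergence carries the bound to the limit.\<close>
  have "(\<lambda>j. \<integral>y. cmod (h j y) ^ p \<partial>M) \<longlonglongrightarrow> (\<integral>y. cmod (\<Sum>\<kappa>\<in>K. a \<kappa> * z \<kappa> * \<psi> \<kappa> y) ^ p \<partial>M)"
  proof (rule integral_dominated_convergence[where w = "\<lambda>_. (\<Sum>\<kappa>\<in>K. cmod (a \<kappa>) * S) ^ p"])
    show "AE y in M. (\<lambda>j. cmod (h j y) ^ p) \<longlonglongrightarrow> cmod (\<Sum>\<kappa>\<in>K. a \<kappa> * z \<kappa> * \<psi> \<kappa> y) ^ p"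
      unfolding h_def using lim by (intro AE_I2 tendsto_intros) (auto simp: v_def)
    show "AE y in M. norm (cmod (h j y) ^ p) \<le> (\<Sum>\<kappa>\<in>K. cmod (a \<kappa>) * S) ^ p" for j
      using hb by (intro AE_I2) (auto simp: space_M intro!: power_mono)
  qed (use hm in auto)
  then show ?thesis
    using le unfolding H_def by (intro LIMSEQ_le_const2) auto
qed

text \<open>Randomization: each sign squares to 1, so it can be inserted twice, once with
  \<open>a\<close> and once with \<open>m\<close>. The factor carrying \<open>m\<close> is removed
  by \<open>integral_approximable_le\<close>; as the left side is free of \<epsilon>, averaging over
  all signs leaves the chaos estimate.\<close>

lemma moment_bound:
  fixes m :: "'i \<Rightarrow> 'c \<Rightarrow> complex"
  assumes I: "finite I" "\<And>i. i \<in> I \<Longrightarrow> finite (F i)"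
    and \<psi>: "\<And>\<kappa>. \<kappa> \<in> PiE I F \<Longrightarrow> \<psi> \<kappa> \<in> characters G T"
    and ap: "\<And>\<epsilon>. \<epsilon> \<in> PiE I (\<lambda>i. PiE (F i) (\<lambda>_. {1, -1 :: real})) \<Longrightarrow>
        approximable (carrier G) \<psi> S (PiE I F) (\<lambda>\<kappa>. \<Prod>i\<in>I. \<epsilon> i (\<kappa> i) * m i (\<kappa> i))"
    and k: "k \<ge> 1"
  shows "(\<integral>y. cmod (\<Sum>\<kappa>\<in>PiE I F. a \<kappa> * (\<Prod>i\<in>I. m i (\<kappa> i)) * \<psi> \<kappa> y) ^ (2 * k) \<partial>M)
    \<le> S ^ (2 * k) * ((96 * real k) ^ k) ^ card I * (\<Sum>\<kappa>\<in>PiE I F. (cmod (a \<kappa>))\<^sup>2) ^ k"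
proof -
  define E where "E = PiE I (\<lambda>i. PiE (F i) (\<lambda>_. {1, -1 :: real}))"
  define L where "L = (\<integral>y. cmod (\<Sum>\<kappa>\<in>PiE I F. a \<kappa> * (\<Prod>i\<in>I. m i (\<kappa> i)) * \<psi> \<kappa> y) ^ (2 * k) \<partial>M)"
  define H where "H \<epsilon> y = (\<Sum>\<kappa>\<in>PiE I F. (\<Prod>i\<in>I. \<epsilon> i (\<kappa> i)) * (a \<kappa> * \<psi> \<kappa> y))"
    for \<epsilon> :: "'i \<Rightarrow> 'c \<Rightarrow> real" and y
  define Q where "Q = ((96 * real k) ^ k) ^ card I * (\<Sum>\<kappa>\<in>PiE I F. (cmod (a \<kappa>))\<^sup>2) ^ k"
  have finK: "finite (PiE I F)"
    using I by (intro finite_PiE)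
  have finE: "finite E"
    unfolding E_def using I by (intro finite_PiE) auto
  have cardE: "real (card E) = (\<Prod>i\<in>I. 2 ^ card (F i))"
    unfolding E_def using I by (simp add: card_PiE)
  have cardE0: "real (card E) > 0"
    unfolding cardE by (intro prod_pos) auto
  have S2: "S ^ (2 * k) \<ge> 0"
    by (simp add: power_mult)
  have [measurable]: "H \<epsilon> \<in> borel_measurable M" for \<epsilon>
    unfolding H_def using \<psi> character_measurable by (auto intro!: borel_measurable_sum borel_measurable_times)
  have Hint: "integrable M (\<lambda>y. cmod (H \<epsilon> y) ^ (2 * k))" for \<epsilon>
  proof (rule integrable_bounded)
    fix y assume "y \<in> carrier G"
    then have "cmod (H \<epsilon> y) \<le> (\<Sum>\<kappa>\<in>PiE I F. cmod (\<Prod>i\<in>I. \<epsilon> i (\<kappa> i)) * cmod (a \<kappa>))"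
      unfolding H_def using \<psi> by (intro sum_norm_le) (auto simp: norm_mult norm_character)
    then show "norm (cmod (H \<epsilon> y) ^ (2 * k)) \<le> (\<Sum>\<kappa>\<in>PiE I F. cmod (\<Prod>i\<in>I. \<epsilon> i (\<kappa> i)) * cmod (a \<kappa>)) ^ (2 * k)"
      by (auto intro!: power_mono)
  qed measurable
  have "L \<le> S ^ (2 * k) * (\<integral>y. cmod (H \<epsilon> y) ^ (2 * k) \<partial>M)" if \<epsilon>: "\<epsilon> \<in> E" for \<epsilon>
  proof -
    have *: "a \<kappa> * (\<Prod>i\<in>I. m i (\<kappa> i)) = ((\<Prod>i\<in>I. \<epsilon> i (\<kappa> i)) * a \<kappa>) * (\<Prod>i\<in>I. \<epsilon> i (\<kappa> i) * m i (\<kappa> i))"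
      if "\<kappa> \<in> PiE I F" for \<kappa>
    proof -
      have "\<epsilon> i (\<kappa> i) * \<epsilon> i (\<kappa> i) = 1" if "i \<in> I" for i
      proof -
        have "\<epsilon> i (\<kappa> i) \<in> {1, -1}"
          by (rule PiE_mem[OF PiE_mem[OF \<epsilon>[unfolded E_def] that] PiE_mem[OF \<open>\<kappa> \<in> PiE I F\<close> that]])
        then show ?thesis by auto
      qed
      then have "(\<Prod>i\<in>I. \<epsilon> i (\<kappa> i)) * (\<Prod>i\<in>I. \<epsilon> i (\<kappa> i)) = 1"
        by (simp flip: prod.distrib)
      then have "complex_of_real (\<Prod>i\<in>I. \<epsilon> i (\<kappa> i)) * complex_of_real (\<Prod>i\<in>I. \<epsilon> i (\<kappa> i)) = 1"
        by (metis of_real_1 of_real_mult)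
      then show ?thesis
        by (simp add: prod.distrib mult_ac)
    qed
    have "L = (\<integral>y. cmod (\<Sum>\<kappa>\<in>PiE I F. ((\<Prod>i\<in>I. \<epsilon> i (\<kappa> i)) * a \<kappa>) * (\<Prod>i\<in>I. \<epsilon> i (\<kappa> i) * m i (\<kappa> i)) * \<psi> \<kappa> y) ^ (2 * k) \<partial>M)"
      unfolding L_def by (simp only: * cong: sum.cong)
    also have "\<dots> \<le> S ^ (2 * k) * (\<integral>y. cmod (\<Sum>\<kappa>\<in>PiE I F. ((\<Prod>i\<in>I. \<epsilon> i (\<kappa> i)) * a \<kappa>) * \<psi> \<kappa> y) ^ (2 * k) \<partial>M)"
      using ap[OF \<epsilon>[unfolded E_def]] k \<psi> by (intro integral_approximable_le finK) auto
    finally show ?thesis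
      by (simp only: H_def mult.assoc)
  qed
  then have "(\<Sum>\<epsilon>\<in>E. L) \<le> (\<Sum>\<epsilon>\<in>E. S ^ (2 * k) * (\<integral>y. cmod (H \<epsilon> y) ^ (2 * k) \<partial>M))"
    by (rule sum_mono)
  also have "\<dots> = S ^ (2 * k) * (\<integral>y. (\<Sum>\<epsilon>\<in>E. cmod (H \<epsilon> y) ^ (2 * k)) \<partial>M)"
    using Hint by (subst Bochner_Integration.integral_sum) (auto simp: sum_distrib_left)
  \<comment> \<open>At each fixed \<open>y\<close> the chaos has coefficients
    \<open>a \<kappa> * \<psi> \<kappa> y\<close>, whose square sum is independent of
    \<open>y\<close> because characters have modulus 1.\<close>
  also have "\<dots> \<le> S ^ (2 * k) * (\<integral>y. card E * Q \<partial>M)"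
  proof (intro mult_left_mono integral_mono S2)
    fix y assume "y \<in> space M"
    then have y: "y \<in> carrier G" by (simp add: space_M)
    have "(\<Sum>\<epsilon>\<in>E. cmod (H \<epsilon> y) ^ (2 * k)) \<le> card E * ((96 * real k) ^ k) ^ card I * (\<Sum>\<kappa>\<in>PiE I F. (cmod (a \<kappa> * \<psi> \<kappa> y))\<^sup>2) ^ k"
      unfolding E_def[symmetric] H_def cardE using Rademacher_chaos[OF I k, where b = "\<lambda>\<kappa>. a \<kappa> * \<psi> \<kappa> y"]
      by (simp add: E_def)
    also have "(\<Sum>\<kappa>\<in>PiE I F. (cmod (a \<kappa> * \<psi> \<kappa> y))\<^sup>2) = (\<Sum>\<kappa>\<in>PiE I F. (cmod (a \<kappa>))\<^sup>2)"
      using \<psi> y by (intro sum.cong) (auto simp: norm_mult norm_character)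
    finally show "(\<Sum>\<epsilon>\<in>E. cmod (H \<epsilon> y) ^ (2 * k)) \<le> card E * Q"
      by (simp add: Q_def mult.assoc)
  qed (use Hint in auto)
  finally have "card E * L \<le> card E * (S ^ (2 * k) * Q)"
    by (simp add: prob_space mult_ac)
  then show ?thesis
    using cardE0 by (simp add: L_def Q_def mult.assoc)
qed

end

section \<open>Pairing with \<open>L log\<^sup>r L\<close>\<close>

text \<open>If the logarithm is below 1, then \<open>cmod z < exp 1 - 1\<close>, hence at most 2;
  otherwise its power is at least 1. On a probability space this places \<open>LlogL\<close> inside
  the integrable functions.\<close>

lemma norm_le_two_plus_LlogL:
  assumes "r \<ge> 0"
  shows "cmod z \<le> 2 + cmod z * ln (1 + cmod z) powr r"
proof (cases "ln (1 + cmod z) < 1")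
  case True
  then have "1 + cmod z < exp 1"
    by (metis add.commute add_nonneg_pos exp_less_cancel_iff exp_ln norm_ge_zero zero_less_one)
  then have "cmod z \<le> 2"
    using exp_le by linarith
  then show ?thesis
    by (intro add_increasing2) auto
next
  case False
  then have "1 \<le> ln (1 + cmod z) powr r"
    using assms by (simp add: ge_one_powr_ge_zero)
  then show ?thesis
    using mult_left_mono[of 1 "ln (1 + cmod z) powr r" "cmod z"] by simp
qed

lemma (in prob_space) LlogL_integrable:
  assumes "f \<in> LlogL r M" "r \<ge> 0"
  shows "integrable M f"
proof (rule Bochner_Integration.integrable_bound)
  show "integrable M (\<lambda>x. 2 + cmod (f x) * ln (1 + cmod (f x)) powr r)"
    using assms by (simp add: LlogL_def)
  show "AE x in M. norm (f x) \<le> norm (2 + cmod (f x) * ln (1 + cmod (f x)) powr r)"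
    using norm_le_two_plus_LlogL[OF assms(2)]
    by (intro AE_I2) (metis abs_ge_self order_trans real_norm_def)
qed (use assms in \<open>simp add: LlogL_def\<close>)

text \<open>
  With \<open>L = ln (1 + \<bar>z\<bar>)\<close> and \<open>k = \<lfloor>L\<rfloor>\<close>: either \<open>\<bar>w\<bar> \<le> A L\<^sup>n\<^sup>/\<^sup>2\<close>, or \<open>\<bar>w\<bar>\<^sup>2 / (A\<^sup>2 k\<^sup>n) \<ge> 1\<close> and
  \<open>\<bar>z\<bar> \<le> e\<^sup>k\<^sup>+\<^sup>1\<close> is absorbed by the power \<open>\<bar>w\<bar>\<^sup>2\<^sup>k\<close>, whose integral is controlled when \<open>w\<close> is a value of \<open>g\<close>.
  The case \<open>L < 1\<close> accounts for the middle term.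
\<close>
lemma LlogL_product_le:
  fixes z w :: complex
  assumes n: "n \<ge> 1" and A: "A \<ge> 1" and W: "(cmod w)\<^sup>2 \<le> real K"
  shows "cmod z * cmod w \<le> A * (cmod z * ln (1 + cmod z) powr (real n / 2)) + 2 * (1 + (cmod w)\<^sup>2)
    + (\<Sum>k=1..K. 3 ^ (k + 1) * (A\<^sup>2 * real k ^ n) / (A\<^sup>2 * real k ^ n) ^ k * cmod w ^ (2 * k))"
proof -
  define L where "L = ln (1 + cmod z)"
  define P where "P = A * (cmod z * L powr (real n / 2))"
  define R where "R k = 3 ^ (k + 1) * (A\<^sup>2 * real k ^ n) / (A\<^sup>2 * real k ^ n) ^ k * cmod w ^ (2 * k)" for k :: nat
  have P0: "P \<ge> 0"
    using A by (simp add: P_def)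
  have R0: "R k \<ge> 0" for k
    by (simp add: R_def)
  then have sumR: "(\<Sum>k=1..K. R k) \<ge> 0"
    by (rule sum_nonneg)
  have expL: "exp L = 1 + cmod z"
    unfolding L_def by (rule exp_ln) (simp add: add_pos_nonneg)
  consider "L < 1" | "L \<ge> 1" "cmod w \<le> A * L powr (real n / 2)" | "L \<ge> 1" "cmod w > A * L powr (real n / 2)"
    by linarith
  then have "cmod z * cmod w \<le> P + 2 * (1 + (cmod w)\<^sup>2) + (\<Sum>k=1..K. R k)"
  proof cases
    case 1
    then have "1 + cmod z < 3"
      using expL exp_le exp_less_cancel_iff[of L 1] by linarith
    then have "cmod z * cmod w \<le> 2 * cmod w"
      by (intro mult_right_mono) auto
    also have "\<dots> \<le> 2 * (1 + (cmod w)\<^sup>2)"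
      using zero_le_power2[of "cmod w - 1/2"] by (simp add: power2_eq_square algebra_simps)
    finally show ?thesis
      using P0 sumR by simp
  next
    case 2
    then have "cmod z * cmod w \<le> P"
      using mult_left_mono[OF 2(2), of "cmod z"] by (simp add: P_def mult_ac)
    moreover have "2 * (1 + (cmod w)\<^sup>2) \<ge> 0"
      by simp
    ultimately show ?thesis
      using sumR by linarith
  next
    case 3
    define k where "k = nat \<lfloor>L\<rfloor>"
    have k: "k \<ge> 1" "real k \<le> L" "L < real k + 1"
      using 3(1) by (auto simp: k_def le_nat_floor)
    define q where "q = A\<^sup>2 * real k ^ n"
    have A2: "A\<^sup>2 \<ge> 1"
      using A by (simp add: one_le_power)
    have "(L powr (real n / 2))\<^sup>2 = L ^ n"
      using 3(1) by (simp add: power2_eq_square powr_realpow flip: powr_add)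
    then have "(A * L powr (real n / 2))\<^sup>2 = A\<^sup>2 * L ^ n"
      by (simp add: power_mult_distrib)
    moreover have "(A * L powr (real n / 2))\<^sup>2 \<le> (cmod w)\<^sup>2"
      using 3(2) A by (intro power_mono) auto
    ultimately have w: "A\<^sup>2 * L ^ n \<le> (cmod w)\<^sup>2"
      by simp
    have q: "q \<le> (cmod w)\<^sup>2"
      unfolding q_def using k A by (intro order_trans[OF _ w] mult_left_mono power_mono) auto
    have "real k \<le> real k ^ n"
      using k n by (simp add: self_le_power)
    then have q1: "real k \<le> q"
      unfolding q_def using mult_mono[of 1 "A\<^sup>2" "real k" "real k ^ n"] A2 by simp
    then have "q \<ge> 1"
      using k by linarith
    \<comment> \<open>Here the bound on \<open>w\<close> enters: it ensures that the index
      \<open>k\<close> occurs in the finite sum.\<close>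
    have "k \<le> K"
      using q q1 W by linarith
    have w1: "cmod w \<ge> 1"
      using q \<open>q \<ge> 1\<close> by (metis abs_norm_cancel order_trans real_le_rsqrt real_sqrt_abs real_sqrt_one real_sqrt_le_iff)
    have "cmod z \<le> exp L"
      by (simp add: expL)
    also have "\<dots> \<le> exp (real (k + 1))"
      using k by simp
    also have "\<dots> \<le> 3 ^ (k + 1)"
      by (rule exp_of_nat_le_3_power)
    finally have z: "cmod z \<le> 3 ^ (k + 1)" .
    have "cmod w \<le> (cmod w)\<^sup>2"
      using w1 by (simp add: self_le_power)
    also have "\<dots> = q * ((cmod w)\<^sup>2 / q)"
      using \<open>q \<ge> 1\<close> by simp
    \<comment> \<open>The quotient \<open>(cmod w)\<^sup>2 / q\<close> is at least 1, so raising it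
      to the power \<open>k\<close> only increases it.\<close>
    also have "\<dots> \<le> q * ((cmod w)\<^sup>2 / q) ^ k"
      using \<open>q \<ge> 1\<close> q k by (intro mult_left_mono self_le_power) auto
    finally have "cmod w \<le> q * ((cmod w)\<^sup>2 / q) ^ k" .
    from mult_mono[OF z this] have "cmod z * cmod w \<le> R k"
      by (simp add: R_def q_def power_mult power_divide)
    also have "\<dots> \<le> (\<Sum>k=1..K. R k)"
      using \<open>k \<le> K\<close> k R0 by (intro member_le_sum) auto
    finally show ?thesis
      using P0 zero_le_power2[of "cmod w"] by (simp only: distrib_left mult_1_right)
  qed
  then show ?thesis
    by (simp add: P_def L_def R_def)
qed

text \<open>The pointwise bound is integrated with \<open>A = 18 * C\<close>; the moment hypothesis
  makes the terms of the sum decay geometrically, so the result does not depend on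
  \<open>W\<close>.\<close>

lemma (in prob_space) LlogL_integral_product_le:
  assumes n: "n \<ge> 1" and C: "C \<ge> 1" and f: "f \<in> LlogL (real n / 2) M"
    and g [measurable]: "g \<in> borel_measurable M" and W: "\<And>x. x \<in> space M \<Longrightarrow> cmod (g x) \<le> W"
    and mom: "\<And>k. k \<ge> 1 \<Longrightarrow> (\<integral>x. cmod (g x) ^ (2 * k) \<partial>M) \<le> C ^ k * (real k ^ k) ^ n"
  shows "(\<integral>x. cmod (f x) * cmod (g x) \<partial>M) \<le>
    18 * C * (\<integral>x. cmod (f x) * ln (1 + cmod (f x)) powr (real n / 2) \<partial>M)
      + (2 * (1 + C) + 3 * (18 * C)\<^sup>2 * fact n)"
proof -
  \<comment> \<open>This choice gives \<open>A\<^sup>2 \<ge> 18 * C\<close>, so the ratio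
    \<open>9 * C / A\<^sup>2\<close> arising below is at most 1/2.\<close>
  define A where "A = 18 * C"
  have A: "A \<ge> 1"
    using C by (simp add: A_def)
  have [measurable]: "f \<in> borel_measurable M"
    using f by (simp add: LlogL_def)
  define \<Phi> where "\<Phi> x = cmod (f x) * ln (1 + cmod (f x)) powr (real n / 2)" for x
  have \<Phi>: "integrable M \<Phi>"
    using f by (simp add: LlogL_def \<Phi>_def[abs_def])
  define K where "K = nat \<lceil>W\<^sup>2\<rceil>"
  define c where "c k = 3 ^ (k + 1) * (A\<^sup>2 * real k ^ n) / (A\<^sup>2 * real k ^ n) ^ k" for k :: nat
  have c0: "c k \<ge> 0" for k
    by (simp add: c_def)
  have gint: "integrable M (\<lambda>x. cmod (g x) ^ p)" for p
    using W by (intro integrable_const_bound[where B = "W ^ p"] AE_I2) (auto intro!: power_mono)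
  have fg: "integrable M (\<lambda>x. cmod (f x) * cmod (g x))"
  proof (rule Bochner_Integration.integrable_bound)
    show "integrable M (\<lambda>x. cmod (f x) * W)"
      using LlogL_integrable[OF f] by simp
    show "AE x in M. norm (cmod (f x) * cmod (g x)) \<le> norm (cmod (f x) * W)"
      using W by (intro AE_I2) (force simp: abs_mult intro: mult_left_mono)
  qed measurable
  have ck: "c k * (\<integral>x. cmod (g x) ^ (2 * k) \<partial>M) \<le> 3 * A\<^sup>2 * fact n * (1/2) ^ k" if k: "k \<ge> 1" for k
  proof -
    have kk: "real k > 0"
      using k by simp
    have "c k * (\<integral>x. cmod (g x) ^ (2 * k) \<partial>M) \<le> c k * (C ^ k * (real k ^ k) ^ n)"
      using c0 mom[OF k] by (intro mult_left_mono)
    \<comment> \<open>The growth \<open>(real k ^ k) ^ n\<close> of the moments cancels against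
      \<open>(real k ^ n) ^ k\<close> in the denominator of \<open>c k\<close>, leaving only the
      factor \<open>real k ^ n\<close>.\<close>
    also have "\<dots> = 3 * A\<^sup>2 * 3 ^ k * real k ^ n * (C / A\<^sup>2) ^ k"
    proof -
      have "(real k ^ k) ^ n = (real k ^ n) ^ k"
        by (simp add: mult.commute flip: power_mult)
      then show ?thesis
        using kk A by (simp add: c_def power_mult_distrib power_divide)
    qed
    also have "\<dots> \<le> 3 * A\<^sup>2 * 3 ^ k * (fact n * 3 ^ k) * (C / A\<^sup>2) ^ k"
    proof (intro mult_right_mono mult_left_mono)
      show "real k ^ n \<le> fact n * 3 ^ k"
        by (rule order_trans[OF power_le_fact_exp mult_left_mono[OF exp_of_nat_le_3_power]]) simp_all
    qed (use C in auto)
    also have "\<dots> = 3 * A\<^sup>2 * fact n * (9 * C / A\<^sup>2) ^ k"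
      by (simp add: power_mult_distrib power_divide mult_ac flip: power_mult_distrib[of 3 3])
    also have "\<dots> \<le> 3 * A\<^sup>2 * fact n * (1/2) ^ k"
    proof (intro mult_left_mono power_mono)
      have "18 * C * 1 \<le> (18 * C) * (18 * C)"
        using C by (intro mult_left_mono) auto
      then show "9 * C / A\<^sup>2 \<le> 1 / 2"
        using C by (simp add: A_def power2_eq_square field_simps)
    qed (use C in auto)
    finally show ?thesis .
  qed
  have "(\<integral>x. cmod (f x) * cmod (g x) \<partial>M) \<le>
      (\<integral>x. A * \<Phi> x + 2 * (1 + cmod (g x) ^ 2) + (\<Sum>k=1..K. c k * cmod (g x) ^ (2 * k)) \<partial>M)"
  proof (rule integral_mono[OF fg])
    fix x assume "x \<in> space M"
    then have "(cmod (g x))\<^sup>2 \<le> W\<^sup>2"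
      using W by (intro power_mono) auto
    also have "W\<^sup>2 \<le> real K"
      unfolding K_def by linarith
    finally show "cmod (f x) * cmod (g x) \<le> A * \<Phi> x + 2 * (1 + cmod (g x) ^ 2) + (\<Sum>k=1..K. c k * cmod (g x) ^ (2 * k))"
      unfolding \<Phi>_def c_def by (rule LlogL_product_le[OF n A])
  qed (use \<Phi> gint in \<open>auto intro!: Bochner_Integration.integrable_add integrable_mult_right Bochner_Integration.integrable_sum\<close>)
  also have "\<dots> = A * (\<integral>x. \<Phi> x \<partial>M) + 2 * (1 + (\<integral>x. cmod (g x) ^ 2 \<partial>M)) + (\<Sum>k=1..K. c k * (\<integral>x. cmod (g x) ^ (2 * k) \<partial>M))"
    using \<Phi> gint by (simp add: prob_space Bochner_Integration.integral_sum)
  also have "\<dots> \<le> A * (\<integral>x. \<Phi> x \<partial>M) + 2 * (1 + C) + (\<Sum>k=1..K. 3 * A\<^sup>2 * fact n * (1/2) ^ k)"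
    using mom[of 1] A by (intro add_mono sum_mono ck mult_left_mono) auto
  also have "(\<Sum>k=1..K. 3 * A\<^sup>2 * fact n * (1/2) ^ k) \<le> 3 * A\<^sup>2 * fact n"
  proof -
    have "(\<Sum>k=1..K. (1/2::real) ^ k) = 1 - (1/2) ^ K"
      by (induction K) auto
    then have "(\<Sum>k=1..K. (1/2::real) ^ k) \<le> 1"
      by simp
    from mult_left_mono[OF this, of "3 * A\<^sup>2 * fact n"] show ?thesis
      by (simp only: sum_distrib_left[symmetric]) simp
  qed
  finally show ?thesis
    by (simp add: A_def \<Phi>_def)
qed

section \<open>Tensor products\<close>

text \<open>The algebraic axioms and continuity are checked coordinatewise; compactness is
  Tychonoff's theorem.\<close>

lemma compact_abelian_group_product_group:
  assumes G: "\<And>i. i \<in> I \<Longrightarrow> compact_abelian_group (G i) (T i)"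
  shows "compact_abelian_group (product_group I G) (product_topology T I)"
proof -
  have top: "topspace (T i) = carrier (G i)" if "i \<in> I" for i
    using compact_abelian_group.topspace_eq[OF G[OF that]] .
  have com: "comm_group (G i)" if "i \<in> I" for i
    using G[OF that] by (simp add: compact_abelian_group_def)
  have grp: "group (G i)" if "i \<in> I" for i
    using com[OF that] by (simp add: comm_group_def)
  have proj: "continuous_map (product_topology T I) (T i) (\<lambda>x. x i)" if "i \<in> I" for i
    using continuous_map_product_projection[OF that] .
  show ?thesis
  proof (intro compact_abelian_group.intro compact_abelian_group_axioms.intro)
    show "comm_group (product_group I G)"
      using com grp
      by (intro group.group_comm_groupI product_group)
         (auto simp: PiE_iff intro!: restrict_ext comm_monoid.m_comm simp: comm_group_def)
    show "topspace (product_topology T I) = carrier (product_group I G)"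
      using top by (auto simp: PiE_iff)
    show "continuous_map (prod_topology (product_topology T I) (product_topology T I)) (product_topology T I)
        (\<lambda>(x, y). x \<otimes>\<^bsub>product_group I G\<^esub> y)"
      unfolding continuous_map_componentwise
    proof (intro conjI ballI)
      fix i assume i: "i \<in> I"
      have "continuous_map (prod_topology (product_topology T I) (product_topology T I))
          (prod_topology (T i) (T i)) (\<lambda>p. (fst p i, snd p i))"
        unfolding continuous_map_pairwise o_def fst_conv snd_conv
        by (intro conjI continuous_map_compose[OF continuous_map_fst proj[OF i], unfolded o_def]
            continuous_map_compose[OF continuous_map_snd proj[OF i], unfolded o_def])
      from continuous_map_compose[OF this compact_abelian_group.continuous_mult[OF G[OF i]]]
      show "continuous_map (prod_topology (product_topology T I) (product_topology T I)) (T i)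
          (\<lambda>p. (case p of (x, y) \<Rightarrow> x \<otimes>\<^bsub>product_group I G\<^esub> y) i)"
        using i by (simp add: o_def case_prod_unfold)
    qed auto
    show "continuous_map (product_topology T I) (product_topology T I) (\<lambda>x. inv\<^bsub>product_group I G\<^esub> x)"
    proof (rule continuous_map_eq)
      show "continuous_map (product_topology T I) (product_topology T I) (\<lambda>x. \<lambda>i\<in>I. inv\<^bsub>G i\<^esub> x i)"
        unfolding continuous_map_componentwise
      proof (intro conjI ballI)
        fix i assume i: "i \<in> I"
        from continuous_map_compose[OF proj[OF i] compact_abelian_group.continuous_inv[OF G[OF i]]] i
        show "continuous_map (product_topology T I) (T i) (\<lambda>x. (\<lambda>i\<in>I. inv\<^bsub>G i\<^esub> x i) i)"
          by (simp add: o_def)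
      qed auto
      fix x assume "x \<in> topspace (product_topology T I)"
      then have "x \<in> carrier (product_group I G)"
        using top by (auto simp: PiE_iff)
      then show "(\<lambda>i\<in>I. inv\<^bsub>G i\<^esub> x i) = inv\<^bsub>product_group I G\<^esub> x"
        using grp by (simp add: inv_product_group)
    qed
    show "compact_space (product_topology T I)"
      using G by (auto simp: compact_space_product_topology intro: compact_abelian_group.compact[OF G])
    show "Hausdorff_space (product_topology T I)"
      using G by (auto simp: Hausdorff_space_product_topology intro: compact_abelian_group.Hausdorff[OF G])
  qed
qed

text \<open>Approximating measures are taken on each factor and multiplied. The weights are
  conjugated because the resulting polynomial is later paired with \<open>f\<close> through its
  conjugate; conjugation preserves moduli, so the same Sidon constants apply.\<close>

lemma tensor_moment_bound:
  fixes G :: "'i \<Rightarrow> ('a, 'b) monoid_scheme"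
  assumes I: "finite I" and H: "\<And>i. i \<in> I \<Longrightarrow> Haar_group (G i) (T i) (\<mu> i)"
    and S: "\<And>i. i \<in> I \<Longrightarrow> Haar_group.Sidon_constant (G i) (T i) (\<mu> i) (m i) (S i)"
    and \<nu>: "Haar_group (product_group I G) (product_topology T I) \<nu>"
    and F: "\<And>i. i \<in> I \<Longrightarrow> finite (F i)" "\<And>i. i \<in> I \<Longrightarrow> F i \<subseteq> weight_support (G i) (T i) (m i)"
    and k: "k \<ge> 1"
  shows "(\<integral>y. cmod (\<Sum>\<kappa>\<in>PiE I F. a \<kappa> * (\<Prod>i\<in>I. cnj (m i (\<kappa> i))) * product_character I G \<kappa> y) ^ (2 * k) \<partial>\<nu>)
    \<le> (\<Prod>i\<in>I. S i) ^ (2 * k) * ((96 * real k) ^ k) ^ card I * (\<Sum>\<kappa>\<in>PiE I F. (cmod (a \<kappa>))\<^sup>2) ^ k"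
proof (rule Haar_group.moment_bound[OF \<nu> I F(1) _ _ k])
  have G: "compact_abelian_group (G i) (T i)" if "i \<in> I" for i
    using H[OF that] by (simp add: Haar_group_def)
  show "product_character I G \<kappa> \<in> characters (product_group I G) (product_topology T I)"
    if "\<kappa> \<in> PiE I F" for \<kappa>
    using that F by (intro product_character_in_characters[OF I G]) (auto simp: weight_support_def PiE_iff)
  fix \<epsilon> assume \<epsilon>: "\<epsilon> \<in> PiE I (\<lambda>i. PiE (F i) (\<lambda>_. {1, -1 :: real}))"
  have "approximable (carrier (G i)) (\<lambda>\<gamma>. \<gamma>) (S i) (F i) (\<lambda>\<gamma>. \<epsilon> i \<gamma> * cnj (m i \<gamma>))" if i: "i \<in> I" for i
  proof (rule Haar_group.Sidon_approximable[OF H[OF i] S[OF i] F(1)[OF i] F(2)[OF i]])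
    fix \<gamma> assume "\<gamma> \<in> F i"
    then have "\<epsilon> i \<gamma> \<in> {1, -1}"
      by (rule PiE_mem[OF PiE_mem[OF \<epsilon> i]])
    then show "cmod (\<epsilon> i \<gamma> * cnj (m i \<gamma>)) \<le> cmod (m i \<gamma>)"
      by (auto simp: norm_mult)
  qed
  from approximable_PiE[OF I this]
  have "approximable (PiE I (\<lambda>i. carrier (G i))) (\<lambda>\<kappa> y. \<Prod>i\<in>I. \<kappa> i (y i)) (\<Prod>i\<in>I. S i) (PiE I F)
      (\<lambda>\<kappa>. \<Prod>i\<in>I. \<epsilon> i (\<kappa> i) * cnj (m i (\<kappa> i)))"
    by simp
  then show "approximable (carrier (product_group I G)) (product_character I G) (\<Prod>i\<in>I. S i) (PiE I F)
      (\<lambda>\<kappa>. \<Prod>i\<in>I. \<epsilon> i (\<kappa> i) * cnj (m i (\<kappa> i)))"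
    unfolding carrier_product_group
    by (rule approximable_cong[rotated]) (simp only: product_character_def restrict_apply if_True)
qed

text \<open>Duality: the square-sum norm is the integral of \<open>f\<close> against the conjugate
  of a polynomial \<open>g\<close> with normalized coefficients. The moments of \<open>g\<close>
  grow slowly enough for the pairing with \<open>LlogL\<close>.\<close>

lemma tensor_finite_bound:
  fixes G :: "'i \<Rightarrow> ('a, 'b) monoid_scheme"
  assumes I: "finite I" "I \<noteq> {}" and H: "\<And>i. i \<in> I \<Longrightarrow> Haar_group (G i) (T i) (\<mu> i)"
    and S: "\<And>i. i \<in> I \<Longrightarrow> Haar_group.Sidon_constant (G i) (T i) (\<mu> i) (m i) (S i)"
    and \<nu>: "Haar_group (product_group I G) (product_topology T I) \<nu>"
    and F: "\<And>i. i \<in> I \<Longrightarrow> finite (F i)" "\<And>i. i \<in> I \<Longrightarrow> F i \<subseteq> weight_support (G i) (T i) (m i)"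
    and f: "f \<in> LlogL (card I / 2) \<nu>"
    and C: "C \<ge> 1" "(\<Prod>i\<in>I. S i)\<^sup>2 * 96 ^ card I \<le> C"
  shows "sqrt (\<Sum>\<kappa>\<in>PiE I F. (cmod ((\<Prod>i\<in>I. m i (\<kappa> i)) * fourier \<nu> f (product_character I G \<kappa>)))\<^sup>2) \<le>
    18 * C * (\<integral>x. cmod (f x) * ln (1 + cmod (f x)) powr (card I / 2) \<partial>\<nu>)
      + (2 * (1 + C) + 3 * (18 * C)\<^sup>2 * fact (card I))"
    (is "?N \<le> ?R")
proof (cases "?N = 0")
  case True
  have "(\<integral>x. cmod (f x) * ln (1 + cmod (f x)) powr (card I / 2) \<partial>\<nu>) \<ge> 0"
    by (intro Bochner_Integration.integral_nonneg) simp
  then show ?thesis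
    using True C by (simp add: add_nonneg_nonneg)
next
  case False
  interpret P: Haar_group "product_group I G" "product_topology T I" \<nu> by fact
  have G: "compact_abelian_group (G i) (T i)" if "i \<in> I" for i
    using H[OF that] by (simp add: Haar_group_def)
  let ?K = "PiE I F"
  let ?\<psi> = "product_character I G"
  have \<psi>: "?\<psi> \<kappa> \<in> characters (product_group I G) (product_topology T I)" if "\<kappa> \<in> ?K" for \<kappa>
    using that F by (intro product_character_in_characters[OF I(1) G]) (auto simp: weight_support_def PiE_iff)
  define c where "c \<kappa> = (\<Prod>i\<in>I. m i (\<kappa> i)) * fourier \<nu> f (?\<psi> \<kappa>)" for \<kappa>
  define N where "N = ?N"
  have N: "N > 0" "N\<^sup>2 = (\<Sum>\<kappa>\<in>?K. (cmod (c \<kappa>))\<^sup>2)"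
  proof -
    show "N > 0"
      unfolding N_def using False by (simp only: order_less_le real_sqrt_ge_zero sum_nonneg zero_le_power2) simp
    show "N\<^sup>2 = (\<Sum>\<kappa>\<in>?K. (cmod (c \<kappa>))\<^sup>2)"
      unfolding N_def c_def by (simp add: sum_nonneg)
  qed
  \<comment> \<open>The unit vector that norms \<open>c\<close>: pairing \<open>c\<close> with
    \<open>cnj (a \<kappa>)\<close> returns \<open>N\<close>. Division by \<open>N\<close> is why
    the case of norm zero is separate.\<close>
  define a where "a \<kappa> = c \<kappa> / N" for \<kappa>
  define g where "g y = (\<Sum>\<kappa>\<in>?K. a \<kappa> * (\<Prod>i\<in>I. cnj (m i (\<kappa> i))) * ?\<psi> \<kappa> y)" for y
  have a1: "(\<Sum>\<kappa>\<in>?K. (cmod (a \<kappa>))\<^sup>2) = 1"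
    unfolding a_def norm_divide power_divide sum_divide_distrib[symmetric] N(2)[symmetric]
    using N(1) by simp
  have gm [measurable]: "g \<in> borel_measurable \<nu>"
    unfolding g_def using \<psi> P.character_measurable by (auto intro!: borel_measurable_sum borel_measurable_times)
  have fm [measurable]: "f \<in> borel_measurable \<nu>"
    using f by (simp add: LlogL_def)
  have fi: "integrable \<nu> f"
    using f by (intro P.LlogL_integrable) auto
  have gb: "cmod (g y) \<le> (\<Sum>\<kappa>\<in>?K. cmod (a \<kappa>) * (\<Prod>i\<in>I. cmod (m i (\<kappa> i))))" if "y \<in> space \<nu>" for y
    unfolding g_def using that \<psi>
    by (intro sum_norm_le) (auto simp: norm_mult P.norm_character P.space_M prod_norm[symmetric])
  have f\<psi>: "integrable \<nu> (\<lambda>x. f x * cnj (?\<psi> \<kappa> x))" if "\<kappa> \<in> ?K" for \<kappa>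
  proof (rule Bochner_Integration.integrable_bound[OF fi])
    have [measurable]: "cnj \<in> borel_measurable borel" "?\<psi> \<kappa> \<in> borel_measurable \<nu>"
      using P.character_measurable[OF \<psi>[OF that]]
      by (auto intro!: borel_measurable_continuous_onI continuous_intros)
    show "(\<lambda>x. f x * cnj (?\<psi> \<kappa> x)) \<in> borel_measurable \<nu>"
      by measurable
    show "AE x in \<nu>. norm (f x * cnj (?\<psi> \<kappa> x)) \<le> norm (f x)"
      using \<psi>[OF that] by (intro AE_I2) (simp add: norm_mult P.norm_character P.space_M)
  qed
  have mom: "(\<integral>x. cmod (g x) ^ (2 * k) \<partial>\<nu>) \<le> C ^ k * (real k ^ k) ^ card I" if k: "k \<ge> 1" for k
  proof -
    have "(\<integral>x. cmod (g x) ^ (2 * k) \<partial>\<nu>) \<le> (\<Prod>i\<in>I. S i) ^ (2 * k) * ((96 * real k) ^ k) ^ card I"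
      using tensor_moment_bound[OF I(1) H S \<nu> F k, of a] by (simp add: g_def a1)
    \<comment> \<open>Everything except \<open>(real k ^ k) ^ card I\<close> is a
      \<open>k\<close>-th power, which explains the lower bound required of
      \<open>C\<close>.\<close>
    also have "\<dots> = ((\<Prod>i\<in>I. S i)\<^sup>2 * 96 ^ card I) ^ k * (real k ^ k) ^ card I"
      by (simp only: power_mult_distrib power_mult[symmetric] mult.commute mult.left_commute mult.assoc)
    also have "\<dots> \<le> C ^ k * (real k ^ k) ^ card I"
      using C by (intro mult_right_mono power_mono) auto
    finally show ?thesis .
  qed
  have "complex_of_real N = (\<Sum>\<kappa>\<in>?K. c \<kappa> * cnj (a \<kappa>))"
  proof -
    have "(\<Sum>\<kappa>\<in>?K. c \<kappa> * cnj (a \<kappa>)) = complex_of_real (\<Sum>\<kappa>\<in>?K. (cmod (c \<kappa>))\<^sup>2) / N"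
      by (simp add: a_def complex_norm_square sum_divide_distrib del: of_real_power)
    also have "\<dots> = N"
      unfolding N(2)[symmetric] using N(1) by (simp add: power2_eq_square)
    finally show ?thesis ..
  qed
  also have "\<dots> = (\<Sum>\<kappa>\<in>?K. (cnj (a \<kappa>) * (\<Prod>i\<in>I. m i (\<kappa> i))) * (\<integral>x. f x * cnj (?\<psi> \<kappa> x) \<partial>\<nu>))"
    by (intro sum.cong refl) (simp add: c_def fourier_def mult_ac)
  also have "\<dots> = (\<integral>x. (\<Sum>\<kappa>\<in>?K. (cnj (a \<kappa>) * (\<Prod>i\<in>I. m i (\<kappa> i))) * (f x * cnj (?\<psi> \<kappa> x))) \<partial>\<nu>)"
    using f\<psi> by (subst Bochner_Integration.integral_sum) auto
  also have "\<dots> = (\<integral>x. f x * cnj (g x) \<partial>\<nu>)"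
    by (simp add: g_def sum_distrib_left mult_ac)
  finally have "N = cmod (\<integral>x. f x * cnj (g x) \<partial>\<nu>)"
    using N(1) by (metis abs_of_pos norm_of_real)
  also have "\<dots> \<le> (\<integral>x. cmod (f x) * cmod (g x) \<partial>\<nu>)"
    using integral_norm_bound[of \<nu> "\<lambda>x. f x * cnj (g x)"] by (simp add: norm_mult)
  also have "\<dots> \<le> ?R"
    using I f gb mom C by (intro P.LlogL_integral_product_le) (auto simp: Suc_le_eq card_gt_0_iff)
  finally show ?thesis
    by (simp add: N_def)
qed

lemma tensor_weight_eq_0_iff:
  "finite I \<Longrightarrow> tensor_weight I G m \<gamma> = 0 \<longleftrightarrow> (\<exists>i\<in>I. m i (coordinate_character I G i \<gamma>) = 0)"
  by (simp add: tensor_weight_def)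

text \<open>After discarding characters of weight zero, a finite set is enclosed in the box spanned
  by its coordinate characters. These lie in the supports of the \<open>m i\<close>, so the estimate
  for boxes applies.\<close>

lemma tensor_weight_finite_bound:
  fixes G :: "'i \<Rightarrow> ('a, 'b) monoid_scheme"
  assumes I: "finite I" "I \<noteq> {}" and H: "\<And>i. i \<in> I \<Longrightarrow> Haar_group (G i) (T i) (\<mu> i)"
    and S: "\<And>i. i \<in> I \<Longrightarrow> Haar_group.Sidon_constant (G i) (T i) (\<mu> i) (m i) (S i)"
    and \<nu>: "Haar_group (product_group I G) (product_topology T I) \<nu>"
    and K: "finite K" "K \<subseteq> characters (product_group I G) (product_topology T I)"
    and f: "f \<in> LlogL (card I / 2) \<nu>"
    and C: "C \<ge> 1" "(\<Prod>i\<in>I. S i)\<^sup>2 * 96 ^ card I \<le> C"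
  shows "sqrt (\<Sum>\<gamma>\<in>K. (cmod (tensor_weight I G m \<gamma> * fourier \<nu> f \<gamma>))\<^sup>2) \<le>
    18 * C * (\<integral>x. cmod (f x) * ln (1 + cmod (f x)) powr (card I / 2) \<partial>\<nu>)
      + (2 * (1 + C) + 3 * (18 * C)\<^sup>2 * fact (card I))"
proof -
  have G: "compact_abelian_group (G i) (T i)" if "i \<in> I" for i
    using H[OF that] by (simp add: Haar_group_def)
  have grp: "group (G i)" if "i \<in> I" for i
    using G[OF that] by (simp add: compact_abelian_group_def comm_group_def)
  define K' where "K' = {\<gamma> \<in> K. tensor_weight I G m \<gamma> \<noteq> 0}"
  define F where "F i = coordinate_character I G i ` K'" for i
  define h where "h \<gamma> = (cmod (tensor_weight I G m \<gamma> * fourier \<nu> f \<gamma>))\<^sup>2" for \<gamma>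
  have finF: "finite (F i)" for i
    using K by (simp add: F_def K'_def)
  have F: "F i \<subseteq> weight_support (G i) (T i) (m i)" if "i \<in> I" for i
  proof
    fix \<gamma> assume "\<gamma> \<in> F i"
    then obtain \<gamma>' where "\<gamma>' \<in> K'" "\<gamma> = coordinate_character I G i \<gamma>'"
      by (auto simp: F_def)
    then show "\<gamma> \<in> weight_support (G i) (T i) (m i)"
      using K(2) I that coordinate_character_in_characters[where G = G, OF I(1) that G]
      by (auto simp: weight_support_def K'_def tensor_weight_eq_0_iff)
  qed
  have FP: "PiE I F \<subseteq> (\<Pi>\<^sub>E i\<in>I. characters (G i) (T i))"
    using F by (intro PiE_mono) (auto simp: weight_support_def)
  have sub: "K' \<subseteq> product_character I G ` PiE I F"
  proof
    fix \<gamma> assume \<gamma>: "\<gamma> \<in> K'"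
    then have "\<gamma> \<in> characters (product_group I G) (product_topology T I)"
      using K by (auto simp: K'_def)
    then have "\<gamma> = product_character I G (\<lambda>j\<in>I. coordinate_character I G j \<gamma>)"
      using product_character_coordinate_character[where G = G, OF I(1) grp] by metis
    moreover have "(\<lambda>j\<in>I. coordinate_character I G j \<gamma>) \<in> PiE I F"
      using \<gamma> by (auto simp: F_def)
    ultimately show "\<gamma> \<in> product_character I G ` PiE I F"
      by blast
  qed
  have inj: "inj_on (product_character I G) (PiE I F)"
    using bij_betw_product_character[where G = G, OF I(1) G] FP
    by (auto simp: bij_betw_def intro: inj_on_subset)
  have "(\<Sum>\<gamma>\<in>K. h \<gamma>) = (\<Sum>\<gamma>\<in>K'. h \<gamma>)"
    using K by (intro sum.mono_neutral_right) (auto simp: K'_def h_def)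
  also have "\<dots> \<le> (\<Sum>\<gamma>\<in>product_character I G ` PiE I F. h \<gamma>)"
    using sub I finF by (intro sum_mono2 finite_imageI finite_PiE) (auto simp: h_def)
  also have "\<dots> = (\<Sum>\<kappa>\<in>PiE I F. (cmod ((\<Prod>i\<in>I. m i (\<kappa> i)) * fourier \<nu> f (product_character I G \<kappa>)))\<^sup>2)"
    unfolding sum.reindex[OF inj] o_def
  proof (intro sum.cong refl)
    fix \<kappa> assume "\<kappa> \<in> PiE I F"
    then have "tensor_weight I G m (product_character I G \<kappa>) = (\<Prod>i\<in>I. m i (\<kappa> i))"
      using FP grp I(1) by (intro tensor_weight_product_character[where T = T]) auto
    then show "h (product_character I G \<kappa>) = (cmod ((\<Prod>i\<in>I. m i (\<kappa> i)) * fourier \<nu> f (product_character I G \<kappa>)))\<^sup>2"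
      by (simp add: h_def)
  qed
  finally have "sqrt (\<Sum>\<gamma>\<in>K. h \<gamma>) \<le> sqrt (\<Sum>\<kappa>\<in>PiE I F. (cmod ((\<Prod>i\<in>I. m i (\<kappa> i)) * fourier \<nu> f (product_character I G \<kappa>)))\<^sup>2)"
    by simp
  also note tensor_finite_bound[OF I H S \<nu> finF F f C]
  finally show ?thesis
    by (simp add: h_def)
qed

lemma bounded_tensor_weight:
  fixes G :: "'i \<Rightarrow> ('a, 'b) monoid_scheme"
  assumes I: "finite I" and H: "\<And>i. i \<in> I \<Longrightarrow> Haar_group (G i) (T i) (\<mu> i)"
    and S: "\<And>i. i \<in> I \<Longrightarrow> Haar_group.Sidon_constant (G i) (T i) (\<mu> i) (m i) (S i)"
  shows "bounded (tensor_weight I G m ` characters (product_group I G) (product_topology T I))"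
  unfolding bounded_iff
proof (intro exI ballI)
  fix z assume "z \<in> tensor_weight I G m ` characters (product_group I G) (product_topology T I)"
  then obtain \<gamma> where \<gamma>: "\<gamma> \<in> characters (product_group I G) (product_topology T I)" "z = tensor_weight I G m \<gamma>"
    by auto
  have G: "compact_abelian_group (G i) (T i)" if "i \<in> I" for i
    using H[OF that] by (simp add: Haar_group_def)
  have "cmod (m i (coordinate_character I G i \<gamma>)) \<le> S i" if "i \<in> I" for i
    by (rule Haar_group.Sidon_weight_bound[OF H[OF that] S[OF that]
        coordinate_character_in_characters[where G = G, OF I that G \<gamma>(1)]])
  then show "norm z \<le> (\<Prod>i\<in>I. S i)"
    by (auto simp: \<gamma>(2) tensor_weight_def prod_norm[symmetric] intro!: prod_mono)
qed

theorem proposition2: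
  fixes n :: nat
    and G :: "nat \<Rightarrow> ('a, 'b) monoid_scheme"
    and T :: "nat \<Rightarrow> 'a topology"
    and \<mu> :: "nat \<Rightarrow> 'a measure"
    and m :: "nat \<Rightarrow> ('a \<Rightarrow> complex) \<Rightarrow> complex"
    and \<nu> :: "(nat \<Rightarrow> 'a) measure"
  defines "GG \<equiv> product_group {1..n} G"
    and "TT \<equiv> product_topology T {1..n}"
    and "mm \<equiv> tensor_weight {1..n} G m"
  assumes "n \<ge> 1"
    and "\<And>j. j \<in> {1..n} \<Longrightarrow> compact_abelian_group (G j) (T j)"
    and "\<And>j. j \<in> {1..n} \<Longrightarrow> normalized_haar_measure (G j) (T j) (\<mu> j)"
    and "\<And>j. j \<in> {1..n} \<Longrightarrow> Sidon_weight (G j) (T j) (\<mu> j) (m j)"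
    and "normalized_haar_measure GG TT \<nu>"
  shows "(\<exists>A>0. \<exists>B>0. \<forall>f\<in>LlogL (real n / 2) \<nu>.
            (\<lambda>\<gamma>. (cmod (mm \<gamma> * fourier \<nu> f \<gamma>))\<^sup>2) summable_on characters GG TT \<and>
            sqrt (\<Sum>\<^sub>\<infinity>\<gamma>\<in>characters GG TT. (cmod (mm \<gamma> * fourier \<nu> f \<gamma>))\<^sup>2)
              \<le> A * (\<integral>x. cmod (f x) * ln (1 + cmod (f x)) powr (real n / 2) \<partial>\<nu>) + B) \<and>
         L2_multiplier GG TT \<nu> mm (LlogL (real n / 2) \<nu>)"
proof -
  let ?I = "{1..n}"
  have I: "finite ?I" "?I \<noteq> {}"
    using \<open>n \<ge> 1\<close> by auto
  have H: "Haar_group (G j) (T j) (\<mu> j)" if "j \<in> ?I" for j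
    using assms(5,6)[OF that] by (simp add: Haar_group_def Haar_group_axioms_def)
  have \<nu>: "Haar_group GG TT \<nu>"
    using compact_abelian_group_product_group[of ?I G T] assms(5,8)
    by (simp add: Haar_group_def Haar_group_axioms_def GG_def TT_def)
  have "\<forall>j\<in>?I. \<exists>S. Haar_group.Sidon_constant (G j) (T j) (\<mu> j) (m j) S"
    using assms(7) Haar_group.Sidon_weight_iff[OF H] by blast
  from bchoice[OF this] obtain S where
    S: "\<And>j. j \<in> ?I \<Longrightarrow> Haar_group.Sidon_constant (G j) (T j) (\<mu> j) (m j) (S j)"
    by blast
  \<comment> \<open>\<open>C\<close> depends only on the Sidon constants and \<open>n\<close>, so
    the same \<open>A\<close> and \<open>B\<close> serve every \<open>f\<close>.\<close>
  define C where "C = max 1 ((\<Prod>i\<in>?I. S i)\<^sup>2 * 96 ^ n)"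
  define A where "A = 18 * C"
  define B where "B = 2 * (1 + C) + 3 * (18 * C)\<^sup>2 * fact n"
  have C: "C \<ge> 1" "(\<Prod>i\<in>?I. S i)\<^sup>2 * 96 ^ card ?I \<le> C"
    by (simp_all add: C_def)
  have AB: "A > 0" "B > 0"
    using C by (auto simp: A_def B_def intro!: add_pos_nonneg)
  have *: "(\<lambda>\<gamma>. (cmod (mm \<gamma> * fourier \<nu> f \<gamma>))\<^sup>2) summable_on characters GG TT \<and>
      sqrt (\<Sum>\<^sub>\<infinity>\<gamma>\<in>characters GG TT. (cmod (mm \<gamma> * fourier \<nu> f \<gamma>))\<^sup>2)
        \<le> A * (\<integral>x. cmod (f x) * ln (1 + cmod (f x)) powr (real n / 2) \<partial>\<nu>) + B" (is "?s summable_on ?X \<and> _ \<le> ?R")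
    if f: "f \<in> LlogL (real n / 2) \<nu>" for f
  proof
    \<comment> \<open>A uniform bound on finite sums of these nonnegative terms gives both
      summability and the bound for the infinite sum.\<close>
    have fin: "sum ?s K \<le> ?R\<^sup>2" if "finite K" "K \<subseteq> ?X" for K
    proof -
      have "sqrt (sum ?s K) \<le> ?R"
        using tensor_weight_finite_bound[OF I H S \<nu>[unfolded GG_def TT_def] that[unfolded GG_def TT_def], of f C] f C
        by (simp add: mm_def A_def B_def)
      then show ?thesis
        by (rule sqrt_le_D)
    qed
    show sm: "?s summable_on ?X"
      using fin by (intro nonneg_bdd_above_summable_on bdd_aboveI[of _ "?R\<^sup>2"]) auto
    have "infsum ?s ?X \<le> ?R\<^sup>2"
      using sm fin by (rule infsum_le_finite_sums)
    moreover have "?R \<ge> 0"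
      using AB by (intro add_nonneg_nonneg mult_nonneg_nonneg Bochner_Integration.integral_nonneg) auto
    ultimately show "sqrt (infsum ?s ?X) \<le> ?R"
      by (rule real_le_lsqrt[rotated 1])
  qed
  have "L2_multiplier GG TT \<nu> mm (LlogL (real n / 2) \<nu>)"
    unfolding L2_multiplier_def
  proof (intro conjI)
    show "bounded (mm ` characters GG TT)"
      unfolding mm_def GG_def TT_def by (rule bounded_tensor_weight[OF I(1) H S])
    interpret P: Haar_group GG TT \<nu> by fact
    show "LlogL (real n / 2) \<nu> \<subseteq> {f. integrable \<nu> f}"
      by (auto intro: P.LlogL_integrable)
  qed (use * in blast)
  with AB * show ?thesis
    by blast
qed

end
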